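(* Let $n\ge3$ and let $A\in\mathbb{C}^{n\times n}$ be a non-normal matrix. Let $\chi_1,\dots,\chi_{n-2}$ be the secondary values of $A$ (listed with multiplicity). Then $$\chi:=\frac{\chi_1+\dots+\chi_{n-2}}{n-2}\in W(A).$$
   Context: The numerical range is $W(A)=\{u^\star Au/u^\star u: u\ne0\}$. The secondary values of $A$ are the solutions $x\in\mathbb{C}$ of $\operatorname{tr}\big(\operatorname{adj}(xI-A)(A^\star-\bar A)\big)=0$, where $\operatorname{adj}$ is the adjugate and $\bar A$ (not the entrywise conjugate) denotes any matrix satisfying: $\bar AA=A\bar A$; $\overline{Q^{-1}AQ}=Q^{-1}\bar AQ$ for all invertible $Q$; and $Au=\mu u$ implies $\bar Au=\bar\mu u$. It need not be unique, but $\operatorname{tr}(\operatorname{adj}(xI-A)\bar A)=\det(xI-A)\sum_j\frac{\bar\lambda_j}{x-\lambda_j}$ for $x\notin\sigma(A)$ (with $\lambda_j$ the eigenvalues of $A$ with multiplicity), so the equation does not depend on the choice. For non-normal $A$ the left-hand side is a polynomial in $x$ of degree exactly $n-2$. *)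

theory Defs
  imports "Jordan_Normal_Form.Schur_Decomposition"
begin

definition mat_trace :: "'a :: comm_monoid_add mat \<Rightarrow> 'a" where
  "mat_trace A = (\<Sum>i<dim_row A. A $$ (i, i))"

definition normal_mat :: "complex mat \<Rightarrow> bool" where
  "normal_mat A \<longleftrightarrow> A * mat_adjoint A = mat_adjoint A * A"

(* The inner product \<bullet>c is conjugate-linear in its second argument,
   so that A u \<bullet>c u is u* A u and u \<bullet>c u is u* u. *)
definition numerical_range :: "complex mat \<Rightarrow> complex set" where
  "numerical_range A =
     {((A *\<^sub>v u) \<bullet>c u) / (u \<bullet>c u) | u. u \<in> carrier_vec (dim_col A) \<and> u \<noteq> 0\<^sub>v (dim_col A)}"

(* cj is an admissible choice of the operation sending A to "A bar" (which is not the entrywise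
   conjugate). The compatibility with similarity relates the values of cj at different matrices,
   which is why the notion is stated for the operation and not for a single pair of matrices.
   Such an operation is not unique; one exists by bar_operation_exists below. *)
definition bar_operation :: "nat \<Rightarrow> (complex mat \<Rightarrow> complex mat) \<Rightarrow> bool" where
  "bar_operation n cj \<longleftrightarrow>
     (\<forall>A \<in> carrier_mat n n. cj A \<in> carrier_mat n n) \<and>
     (\<forall>A \<in> carrier_mat n n. cj A * A = A * cj A) \<and>
     (\<forall>A \<in> carrier_mat n n. \<forall>Q \<in> carrier_mat n n. \<forall>P \<in> carrier_mat n n.
        inverts_mat Q P \<longrightarrow> inverts_mat P Q \<longrightarrow> cj (P * A * Q) = P * cj A * Q) \<and>
     (\<forall>A \<in> carrier_mat n n. \<forall>u \<mu>. eigenvector A u \<mu> \<longrightarrow> cj A *\<^sub>v u = cnj \<mu> \<cdot>\<^sub>v u)"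

(* The polynomial tr (adj (x I - A) (A* - B)) in x, where B is meant to be "A bar"; note that
   char_poly_matrix A is the polynomial matrix x I - A. See poly_secondary_poly below. *)
definition secondary_poly :: "complex mat \<Rightarrow> complex mat \<Rightarrow> complex poly" where
  "secondary_poly A B =
     mat_trace (adj_mat (char_poly_matrix A) * map_mat (\<lambda>c. [:c:]) (mat_adjoint A - B))"

definition secondary_values :: "complex mat \<Rightarrow> complex mat \<Rightarrow> complex multiset" where
  "secondary_values A B = proots (secondary_poly A B)"

lemma mat_adjoint_carrier:
  "A \<in> carrier_mat n n \<Longrightarrow> mat_adjoint A \<in> carrier_mat n n"
  unfolding mat_adjoint_def by auto

lemma mat_adjoint_index:
  fixes A :: "complex mat"
  assumes "A \<in> carrier_mat n m" "i < m" "j < n"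
  shows "mat_adjoint A $$ (i, j) = cnj (A $$ (j, i))"
  using assms unfolding mat_adjoint_def by (auto simp: mat_of_rows_def)

lemma poly_secondary_poly:
  assumes A: "A \<in> carrier_mat n n" and B: "B \<in> carrier_mat n n"
  shows "poly (secondary_poly A B) x =
    mat_trace (adj_mat (x \<cdot>\<^sub>m 1\<^sub>m n - A) * (mat_adjoint A - B))"
proof -
  let ?C = "char_poly_matrix A"
  have C: "?C \<in> carrier_mat n n" using A by simp
  have X: "x \<cdot>\<^sub>m 1\<^sub>m n - A \<in> carrier_mat n n" using A by auto
  note adjA = mat_adjoint_carrier[OF A]
  have E: "map_mat (\<lambda>p. poly p x) ?C = x \<cdot>\<^sub>m 1\<^sub>m n - A"
    using A by (intro eq_matI) (auto simp: char_poly_matrix_def)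
  have cof: "poly (cofactor ?C i j) x = cofactor (x \<cdot>\<^sub>m 1\<^sub>m n - A) i j" if "i < n" "j < n" for i j
  proof -
    have "map_mat (\<lambda>p. poly p x) (mat_delete ?C i j) = mat_delete (map_mat (\<lambda>p. poly p x) ?C) i j"
      using C that by (intro eq_matI) (auto simp: mat_delete_def)
    hence "det (mat_delete (x \<cdot>\<^sub>m 1\<^sub>m n - A) i j) = poly (det (mat_delete ?C i j)) x"
      unfolding E by (simp add: comm_ring_hom.hom_det[OF poly_hom.comm_ring_hom_axioms, of x, symmetric])
    thus ?thesis by (simp add: cofactor_def)
  qed
  show ?thesis
    unfolding secondary_poly_def mat_trace_def
    using A B C carrier_matD[OF C] X adjA
    by (auto simp: poly_sum scalar_prod_def adj_mat_def cof intro!: sum.cong)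
qed

text \<open>Existence of a bar operation: evaluate at the matrix a polynomial, depending only on its
  set of eigenvalues, that interpolates complex conjugation on this set.\<close>

primrec eval_mat :: "nat \<Rightarrow> complex list \<Rightarrow> complex mat \<Rightarrow> complex mat" where
  "eval_mat n [] A = 0\<^sub>m n n"
| "eval_mat n (c # cs) A = c \<cdot>\<^sub>m 1\<^sub>m n + A * eval_mat n cs A"

lemma eval_mat_carrier: "A \<in> carrier_mat n n \<Longrightarrow> eval_mat n cs A \<in> carrier_mat n n"
  by (induction cs) auto

lemma eval_mat_commute:
  assumes A: "A \<in> carrier_mat n n"
  shows "eval_mat n cs A * A = A * eval_mat n cs A"
proof (induction cs)
  case (Cons c cs)
  note E = eval_mat_carrier[OF A, of cs]
  have "(c \<cdot>\<^sub>m 1\<^sub>m n + A * eval_mat n cs A) * A = c \<cdot>\<^sub>m A + A * eval_mat n cs A * A"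
    using A E by (subst add_mult_distrib_mat[of _ n n]) auto
  also have "A * eval_mat n cs A * A = A * (A * eval_mat n cs A)"
    using A E Cons by (simp add: assoc_mult_mat[of _ n n _ n _ n])
  also have "c \<cdot>\<^sub>m A + A * (A * eval_mat n cs A) = A * (c \<cdot>\<^sub>m 1\<^sub>m n + A * eval_mat n cs A)"
    using A E by (subst mult_add_distrib_mat[of _ n n _ n]) auto
  finally show ?case by simp
qed (use A in auto)

lemma eval_mat_similar:
  assumes A: "A \<in> carrier_mat n n" and P: "P \<in> carrier_mat n n" and Q: "Q \<in> carrier_mat n n"
    and QP: "Q * P = 1\<^sub>m n" and PQ: "P * Q = 1\<^sub>m n"
  shows "eval_mat n cs (P * A * Q) = P * eval_mat n cs A * Q"
proof (induction cs)
  case (Cons c cs)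
  note E = eval_mat_carrier[OF A, of cs]
  let ?E = "eval_mat n cs A"
  have "P * A * Q * (P * ?E * Q) = P * A * (Q * P) * ?E * Q"
    using A P Q E by (simp add: assoc_mult_mat[of _ n n _ n _ n])
  also have "\<dots> = P * (A * ?E) * Q"
    using A P Q E QP by (simp add: assoc_mult_mat[of _ n n _ n _ n])
  finally have 1: "P * A * Q * (P * ?E * Q) = P * (A * ?E) * Q" .
  have "P * (c \<cdot>\<^sub>m 1\<^sub>m n + A * ?E) * Q = (c \<cdot>\<^sub>m P + P * (A * ?E)) * Q"
    using A P Q E
    by (subst mult_add_distrib_mat[of _ n n _ n]) (auto simp: mult_smult_distrib[of _ n n _ n])
  also have "\<dots> = c \<cdot>\<^sub>m 1\<^sub>m n + P * (A * ?E) * Q"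
    using A P Q E PQ by (subst add_mult_distrib_mat[of _ n n]) (auto simp: mult_smult_assoc_mat[of _ n n _ n])
  finally show ?case using Cons 1 by simp
qed (use P Q in auto)

lemma eval_mat_eigenvector:
  assumes A: "A \<in> carrier_mat n n" and u: "u \<in> carrier_vec n" and Au: "A *\<^sub>v u = \<mu> \<cdot>\<^sub>v u"
  shows "eval_mat n cs A *\<^sub>v u = poly (Poly cs) \<mu> \<cdot>\<^sub>v u"
proof (induction cs)
  case (Cons c cs)
  note E = eval_mat_carrier[OF A, of cs]
  have "(c \<cdot>\<^sub>m 1\<^sub>m n + A * eval_mat n cs A) *\<^sub>v u = c \<cdot>\<^sub>v u + A *\<^sub>v (eval_mat n cs A *\<^sub>v u)"
    using A E u by (subst add_mult_distrib_mat_vec[of _ n n]) auto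
  also have "A *\<^sub>v (eval_mat n cs A *\<^sub>v u) = poly (Poly cs) \<mu> \<cdot>\<^sub>v (\<mu> \<cdot>\<^sub>v u)"
    using A u Cons Au by (simp add: mult_mat_vec[of _ n n])
  also have "c \<cdot>\<^sub>v u + poly (Poly cs) \<mu> \<cdot>\<^sub>v (\<mu> \<cdot>\<^sub>v u) = poly (Poly (c # cs)) \<mu> \<cdot>\<^sub>v u"
    using u by (intro eq_vecI) (auto simp: algebra_simps)
  finally show ?case by simp
qed (use u in auto)

lemma interpolation_exists:
  fixes S :: "complex set"
  assumes "finite S"
  shows "\<exists>p. \<forall>x\<in>S. poly p x = f x"
  using assms
proof (induction S)
  case (insert a S)
  then obtain p where p: "\<And>x. x \<in> S \<Longrightarrow> poly p x = f x" by blast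
  define q where "q = (\<Prod>x\<in>S. [:-x, 1:])"
  have q0: "poly q x = 0" if "x \<in> S" for x
    using that insert by (auto simp: q_def poly_prod)
  have qa: "poly q a \<noteq> 0"
    using insert by (auto simp: q_def poly_prod)
  have "poly (p + smult ((f a - poly p a) / poly q a) q) x = f x" if "x \<in> insert a S" for x
    using that p q0 qa by auto
  thus ?case by blast
qed auto

lemma bar_operation_exists: "\<exists>cj. bar_operation n cj"
proof -
  have fin: "finite {x. eigenvalue A x}" if "A \<in> carrier_mat n n" for A :: "complex mat"
  proof -
    have "char_poly A \<noteq> 0" using degree_monic_char_poly[OF that] by auto
    thus ?thesis using that by (simp add: eigenvalue_root_char_poly poly_roots_finite)
  qed
  have "\<forall>S. \<exists>p. finite S \<longrightarrow> (\<forall>x\<in>S. poly p x = cnj x)"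
    using interpolation_exists[of _ cnj] by blast
  then obtain p where p: "\<And>S x. finite S \<Longrightarrow> x \<in> S \<Longrightarrow> poly (p S) x = cnj x" by metis
  define cj where "cj A = eval_mat n (coeffs (p {x. eigenvalue A x})) A" for A
  have spec: "{x. eigenvalue (P * A * Q) x} = {x. eigenvalue A x}"
    if "A \<in> carrier_mat n n" "Q \<in> carrier_mat n n" "P \<in> carrier_mat n n"
      "Q * P = 1\<^sub>m n" "P * Q = 1\<^sub>m n" for A P Q :: "complex mat"
  proof -
    have "similar_mat (P * A * Q) A"
      using that unfolding similar_mat_def similar_mat_wit_def
      by (intro exI[of _ P] exI[of _ Q]) (auto simp: Let_def)
    from char_poly_similar[OF this] have "char_poly (P * A * Q) = char_poly A" .
    moreover have "P * A * Q \<in> carrier_mat n n" using that by auto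
    ultimately show ?thesis using that(1) by (simp add: eigenvalue_root_char_poly)
  qed
  have "cj A *\<^sub>v u = cnj \<mu> \<cdot>\<^sub>v u" if A: "A \<in> carrier_mat n n" and "eigenvector A u \<mu>" for A u \<mu>
  proof -
    have "eigenvalue A \<mu>" using that unfolding eigenvalue_def by blast
    with p[OF fin[OF A]] have "poly (p {x. eigenvalue A x}) \<mu> = cnj \<mu>" by simp
    with eval_mat_eigenvector[OF A, of u \<mu> "coeffs (p {x. eigenvalue A x})"] that show ?thesis
      unfolding cj_def eigenvector_def by simp
  qed
  moreover have "cj (P * A * Q) = P * cj A * Q"
    if "A \<in> carrier_mat n n" "Q \<in> carrier_mat n n" "P \<in> carrier_mat n n"
      "inverts_mat Q P" "inverts_mat P Q" for A P Q
  proof -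
    have inv: "Q * P = 1\<^sub>m n" "P * Q = 1\<^sub>m n" using that by (auto simp: inverts_mat_def)
    show ?thesis
      unfolding cj_def spec[OF that(1-3) inv] by (rule eval_mat_similar[OF that(1,3,2) inv])
  qed
  ultimately have "bar_operation n cj"
    unfolding bar_operation_def
    by (auto simp: cj_def eval_mat_carrier eval_mat_commute)
  thus ?thesis by blast
qed

end

theory Submission
  imports Defs "HOL-Analysis.Convex"
begin

text \<open>Let \<open>M = A\<^sup>* - cj A\<close>. The identity \<open>x adj(x I - A) = \<chi>(x) I + adj(x I - A) A\<close> gives the
  leading coefficients of the secondary polynomial: since \<open>tr M = 0\<close>, it has degree \<open>n - 2\<close> and its
  roots add up to \<open>tr A - tr(A\<^sup>2 M) / tr(A M)\<close>. By unitary invariance \<open>A\<close> may be replaced with an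
  upper triangular matrix \<open>T\<close> with entries \<open>t\<^sub>p\<^sub>q\<close>, and then \<open>tr(T M)\<close> is the sum of the
  \<open>\<bar>t\<^sub>p\<^sub>q\<bar>\<^sup>2\<close> over \<open>p < q\<close>, which is positive unless \<open>T\<close> is diagonal.
  For each triple \<open>i < k < j\<close> let \<open>u\<close> be the vector whose entries at \<open>i\<close>, \<open>k\<close>, \<open>j\<close> are
  \<open>cnj t\<^sub>k\<^sub>j\<close>, \<open>- cnj t\<^sub>i\<^sub>j\<close>, \<open>t\<^sub>i\<^sub>k\<close>. Summed over all triples, \<open>u\<^sup>* T u\<close> gives
  \<open>tr T tr(T M) - tr(T\<^sup>2 M)\<close> and \<open>u\<^sup>* u\<close> gives \<open>(n - 2) tr(T M)\<close>, so that the mean of the secondary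
  values is a convex combination of points of the numerical range, which is convex by the
  Toeplitz--Hausdorff theorem.\<close>

section \<open>Unitary triangularization\<close>

lemma scalar_prod_conj_sum:
  "v \<bullet>c w = (\<Sum>i<dim_vec w. v $ i * cnj (w $ i))" for v w :: "complex vec"
  by (simp add: scalar_prod_def lessThan_atLeast0)

lemma mat_adjoint_dim [simp]: "dim_row (mat_adjoint A) = dim_col A" "dim_col (mat_adjoint A) = dim_row A"
  by (auto simp: mat_adjoint_def)

lemma mat_adjoint_nth [simp]:
  fixes A :: "complex mat"
  shows "i < dim_col A \<Longrightarrow> j < dim_row A \<Longrightarrow> mat_adjoint A $$ (i, j) = cnj (A $$ (j, i))"
  by (rule mat_adjoint_index[of A "dim_row A" "dim_col A"]) auto

lemma mat_adjoint_mult: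
  fixes A B :: "complex mat"
  assumes "A \<in> carrier_mat n m" "B \<in> carrier_mat m k"
  shows "mat_adjoint (A * B) = mat_adjoint B * mat_adjoint A"
  using assms by (intro eq_matI) (auto simp: scalar_prod_def intro!: sum.cong)

lemma mat_adjoint_adjoint [simp]:
  fixes A :: "complex mat"
  shows "mat_adjoint (mat_adjoint A) = A"
  by (intro eq_matI) auto

lemma mult_mat_vec_cscalar_prod:
  fixes A :: "complex mat"
  assumes "A \<in> carrier_mat n m" "v \<in> carrier_vec m" "w \<in> carrier_vec n"
  shows "(A *\<^sub>v v) \<bullet>c w = v \<bullet>c (mat_adjoint A *\<^sub>v w)"
proof -
  have "(A *\<^sub>v v) \<bullet>c w = (\<Sum>i<n. \<Sum>j<m. A $$ (i, j) * v $ j * cnj (w $ i))"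
    using assms by (auto simp: scalar_prod_conj_sum scalar_prod_def sum_distrib_right lessThan_atLeast0
      intro!: sum.cong)
  also have "\<dots> = (\<Sum>j<m. \<Sum>i<n. A $$ (i, j) * v $ j * cnj (w $ i))"
    by (rule sum.swap)
  also have "\<dots> = v \<bullet>c (mat_adjoint A *\<^sub>v w)"
    using assms by (auto simp: scalar_prod_conj_sum scalar_prod_def sum_distrib_left lessThan_atLeast0
      intro!: sum.cong)
  finally show ?thesis .
qed

definition unitary_mat :: "nat \<Rightarrow> complex mat \<Rightarrow> bool" where
  "unitary_mat n U \<longleftrightarrow> U \<in> carrier_mat n n \<and> mat_adjoint U * U = 1\<^sub>m n \<and> U * mat_adjoint U = 1\<^sub>m n"

text \<open>A left inverse of a square matrix is also a right inverse, so one of the two identities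
  suffices.\<close>

lemma unitary_matI:
  assumes "U \<in> carrier_mat n n" "mat_adjoint U * U = 1\<^sub>m n"
  shows "unitary_mat n U"
  using assms mat_mult_left_right_inverse[of "mat_adjoint U" n U] mat_adjoint_carrier[of U n]
  by (auto simp: unitary_mat_def)

lemma unitary_mat_mult:
  assumes "unitary_mat n U" "unitary_mat n V"
  shows "unitary_mat n (U * V)"
proof -
  have c: "U \<in> carrier_mat n n" "V \<in> carrier_mat n n"
    and e: "mat_adjoint U * U = 1\<^sub>m n" "mat_adjoint V * V = 1\<^sub>m n"
    using assms by (auto simp: unitary_mat_def)
  note a = mat_adjoint_carrier[OF c(1)] mat_adjoint_carrier[OF c(2)]
  have "mat_adjoint (U * V) * (U * V) = mat_adjoint V * (mat_adjoint U * U) * V"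
    using c a by (simp add: mat_adjoint_mult[OF c] assoc_mult_mat[of _ n n _ n _ n])
  also have "\<dots> = 1\<^sub>m n" unfolding e(1) right_mult_one_mat[OF a(2)] by (rule e(2))
  finally show ?thesis using c by (intro unitary_matI) auto
qed

lemma cscalar_prod_self_normalize:
  fixes v :: "complex vec"
  assumes v: "v \<in> carrier_vec n" "v \<noteq> 0\<^sub>v n"
  obtains c where "c \<noteq> 0" "(c \<cdot>\<^sub>v v) \<bullet>c (c \<cdot>\<^sub>v v) = 1"
proof -
  define r where "r = (\<Sum>i<n. (cmod (v $ i))\<^sup>2)"
  have e: "v \<bullet>c v = of_real r"
    using v unfolding r_def scalar_prod_conj_sum of_real_sum
    by (auto simp: complex_norm_square[symmetric] intro!: sum.cong)
  have "r \<noteq> 0" using e v by auto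
  moreover have "r \<ge> 0" unfolding r_def by (intro sum_nonneg) auto
  ultimately have r: "r > 0" by simp
  let ?c = "complex_of_real (1 / sqrt r)"
  have "(?c \<cdot>\<^sub>v v) \<bullet>c (?c \<cdot>\<^sub>v v) = ?c * cnj ?c * (v \<bullet>c v)"
    using v by (simp add: scalar_prod_conj_sum sum_distrib_left mult_ac)
  also have "\<dots> = of_real (1 / sqrt r * (1 / sqrt r) * r)"
    unfolding e of_real_mult by simp
  also have "1 / sqrt r * (1 / sqrt r) * r = 1" using r by (simp add: field_simps)
  finally show thesis using r by (intro that[of ?c]) auto
qed

text \<open>Gram-Schmidt applied to a basis that starts with \<open>v\<close> keeps \<open>v\<close>
  as its first vector and makes the family orthogonal but not orthonormal. Scaling every column to
  length 1 gives a unitary matrix, which is why the first column is only a multiple of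
  \<open>v\<close>.\<close>

lemma unitary_mat_first_column:
  fixes v :: "complex vec"
  assumes v: "v \<in> carrier_vec n" "v \<noteq> 0\<^sub>v n"
  obtains W c where "unitary_mat n W" "col W 0 = c \<cdot>\<^sub>v v" "c \<noteq> 0"
proof -
  interpret cof_vec_space n "TYPE(complex)" .
  have n: "n > 0" using v by (cases n) auto
  define ws where "ws = gram_schmidt n (basis_completion v)"
  note b = basis_completion[OF v]
  from b(6) b(7) n obtain vs where vs: "basis_completion v = v # vs"
    by (cases "basis_completion v") auto
  note g = gram_schmidt_result[OF b(2,4,5) ws_def]
  have ws: "length ws = n" "set ws \<subseteq> carrier_vec n" "corthogonal ws" using g b by auto
  have w0: "ws ! 0 = v"
    using gram_schmidt_hd[OF v(1), of vs] ws n unfolding ws_def[symmetric] vs[symmetric]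
    by (metis hd_conv_nth length_greater_0_conv vs ws_def)
  have wi: "ws ! i \<in> carrier_vec n" if "i < n" for i using ws that by auto
  have wz: "ws ! i \<noteq> 0\<^sub>v n" if "i < n" for i
    using corthogonalD[OF ws(3), of i i] that ws by auto
  have "\<exists>c. c \<noteq> 0 \<and> (c \<cdot>\<^sub>v ws ! i) \<bullet>c (c \<cdot>\<^sub>v ws ! i) = 1" if "i < n" for i
    using cscalar_prod_self_normalize[OF wi[OF that] wz[OF that]] by metis
  then obtain c where c: "\<And>i. i < n \<Longrightarrow> c i \<noteq> 0 \<and> (c i \<cdot>\<^sub>v ws ! i) \<bullet>c (c i \<cdot>\<^sub>v ws ! i) = 1"
    by metis
  define W where "W = mat n n (\<lambda>(i, j). c j * ws ! j $ i)"
  have W: "W \<in> carrier_mat n n" by (simp add: W_def)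
  have entry: "(mat_adjoint W * W) $$ (i, j) = (c j \<cdot>\<^sub>v ws ! j) \<bullet>c (c i \<cdot>\<^sub>v ws ! i)"
    if "i < n" "j < n" for i j
    using that wi[of i] wi[of j]
    by (auto simp: W_def scalar_prod_def mult_ac intro!: sum.cong)
  have ortho: "(c j \<cdot>\<^sub>v ws ! j) \<bullet>c (c i \<cdot>\<^sub>v ws ! i) = 0" if "i < n" "j < n" "i \<noteq> j" for i j
  proof -
    have "(c j \<cdot>\<^sub>v ws ! j) \<bullet>c (c i \<cdot>\<^sub>v ws ! i) = c j * cnj (c i) * (ws ! j \<bullet>c ws ! i)"
      using that wi[of i] wi[of j] by (simp add: scalar_prod_conj_sum sum_distrib_left mult_ac)
    thus ?thesis using corthogonalD[OF ws(3), of j i] that ws by auto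
  qed
  have "mat_adjoint W * W = 1\<^sub>m n"
  proof (intro eq_matI)
    fix i j assume "i < dim_row (1\<^sub>m n :: complex mat)" "j < dim_col (1\<^sub>m n :: complex mat)"
    hence ij: "i < n" "j < n" by auto
    thus "(mat_adjoint W * W) $$ (i, j) = 1\<^sub>m n $$ (i, j)"
      using entry[OF ij] ortho[OF ij] c[of i] by auto
  qed (use W in auto)
  moreover have "col W 0 = c 0 \<cdot>\<^sub>v v"
    using n w0 v by (intro eq_vecI) (auto simp: W_def)
  ultimately show thesis using W c[OF n] by (intro that[of W "c 0"] unitary_matI) auto
qed

text \<open>Deflation by induction on the dimension: conjugating by a unitary matrix whose first
  column is an eigenvector clears the first column below the diagonal, and the induction hypothesis
  triangularizes the remaining block \<open>A3\<close>.\<close>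

theorem unitary_schur:
  fixes A :: "complex mat"
  assumes "A \<in> carrier_mat n n"
  shows "\<exists>U T. unitary_mat n U \<and> T \<in> carrier_mat n n \<and> upper_triangular T \<and> A = U * T * mat_adjoint U"
  using assms
proof (induction n arbitrary: A)
  case 0
  thus ?case
    by (intro exI[of _ "1\<^sub>m 0"] exI[of _ A]) (auto simp: unitary_mat_def intro!: eq_matI)
next
  case (Suc m A)
  let ?n = "Suc m"
  note A = Suc.prems
  obtain as where as: "char_poly A = (\<Prod>a\<leftarrow>as. [:- a, 1:])" "length as = ?n"
    using char_poly_factorized[OF A] by blast
  then obtain e as' where "as = e # as'" by (cases as) auto
  hence "eigenvalue A e" using as by (simp add: eigenvalue_root_char_poly[OF A])
  then obtain v where v: "v \<in> carrier_vec ?n" "v \<noteq> 0\<^sub>v ?n" and Av: "A *\<^sub>v v = e \<cdot>\<^sub>v v"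
    using A by (auto simp: eigenvalue_def eigenvector_def)
  from unitary_mat_first_column[OF v] obtain W c
    where W: "unitary_mat ?n W" and W0: "col W 0 = c \<cdot>\<^sub>v v" and c0: "c \<noteq> 0" by metis
  have Wc: "W \<in> carrier_mat ?n ?n" and WW: "mat_adjoint W * W = 1\<^sub>m ?n" "W * mat_adjoint W = 1\<^sub>m ?n"
    using W by (auto simp: unitary_mat_def)
  note Wa = mat_adjoint_carrier[OF Wc]
  define B where "B = mat_adjoint W * A * W"
  have B: "B \<in> carrier_mat ?n ?n" using Wc Wa A by (auto simp: B_def)
  have colB: "col B 0 = e \<cdot>\<^sub>v unit_vec ?n 0"
  proof -
    have "col B 0 = mat_adjoint W * A *\<^sub>v col W 0"
      using Wc by (auto simp: B_def)
    also have "\<dots> = mat_adjoint W *\<^sub>v (A *\<^sub>v col W 0)"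
      using Wa A col_dim[of W 0] Wc by (intro assoc_mult_mat_vec[of _ ?n ?n _ ?n]) auto
    also have "A *\<^sub>v col W 0 = e \<cdot>\<^sub>v col W 0"
      unfolding W0 using A v Av
      by (simp add: mult_mat_vec[of _ ?n ?n] smult_smult_assoc mult.commute)
    also have "mat_adjoint W *\<^sub>v (e \<cdot>\<^sub>v col W 0) = e \<cdot>\<^sub>v (mat_adjoint W *\<^sub>v col W 0)"
      using Wa Wc col_dim[of W 0] by (intro mult_mat_vec[of _ ?n ?n]) auto
    also have "mat_adjoint W *\<^sub>v col W 0 = col (mat_adjoint W * W) 0" using Wc by auto
    also have "\<dots> = unit_vec ?n 0" unfolding WW by simp
    finally show ?thesis .
  qed
  obtain A1 A2 A0 A3 where split: "split_block B 1 1 = (A1, A2, A0, A3)"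
    by (cases "split_block B 1 1") auto
  have "dim_row B = 1 + m" "dim_col B = 1 + m" using B by auto
  note sb = split_block[OF split this]
  have A0: "A0 = 0\<^sub>m m 1"
  proof (intro eq_matI)
    fix i j assume "i < dim_row (0\<^sub>m m 1 :: complex mat)" "j < dim_col (0\<^sub>m m 1 :: complex mat)"
    hence "i < m" "j = 0" by auto
    moreover have "B $$ (Suc i, 0) = col B 0 $ Suc i" using B \<open>i < m\<close> by simp
    ultimately show "A0 $$ (i, j) = 0\<^sub>m m 1 $$ (i, j)"
      using split B colB by (auto simp: split_block_def Let_def)
  qed (use sb in auto)
  obtain V T where V: "unitary_mat m V" and T: "T \<in> carrier_mat m m" "upper_triangular T"
    and A3: "A3 = V * T * mat_adjoint V"
    using Suc.IH[OF sb(4)] by blast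
  have Vc: "V \<in> carrier_mat m m" and VV: "mat_adjoint V * V = 1\<^sub>m m" "V * mat_adjoint V = 1\<^sub>m m"
    using V by (auto simp: unitary_mat_def)
  note Va = mat_adjoint_carrier[OF Vc]
  \<comment> \<open>\<open>V'\<close> extends \<open>V\<close> by the identity on the first
    coordinate, so that conjugation by it acts on the block \<open>A3\<close> and keeps the zeros
    below the first diagonal entry; \<open>T'\<close> is \<open>B\<close> in the new basis.\<close>
  define V' where "V' = four_block_mat (1\<^sub>m 1) (0\<^sub>m 1 m) (0\<^sub>m m 1) V"
  define T' where "T' = four_block_mat A1 (A2 * V) (0\<^sub>m m 1) T"
  have V'c: "V' \<in> carrier_mat ?n ?n" and T'c: "T' \<in> carrier_mat ?n ?n"
    using Vc T sb by (auto simp: V'_def T'_def)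
  have V'a: "mat_adjoint V' = four_block_mat (1\<^sub>m 1) (0\<^sub>m 1 m) (0\<^sub>m m 1) (mat_adjoint V)"
    using Vc by (intro eq_matI) (auto simp: V'_def)
  have uV': "unitary_mat ?n V'"
  proof (intro unitary_matI V'c)
    show "mat_adjoint V' * V' = 1\<^sub>m ?n"
      unfolding V'a unfolding V'_def using Vc Va VV
      by (subst mult_four_block_mat[of _ 1 1 _ m _ m _ _ 1 _ m]) auto
  qed
  have "V' * T' = four_block_mat A1 (A2 * V) (0\<^sub>m m 1) (V * T)"
    unfolding V'_def T'_def using Vc T sb
    by (subst mult_four_block_mat[of _ 1 1 _ m _ m _ _ 1 _ m]) auto
  also have "\<dots> * mat_adjoint V' = four_block_mat A1 (A2 * V * mat_adjoint V) (0\<^sub>m m 1) A3"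
    unfolding V'a A3 using Vc Va T sb(1,2)
    by (subst mult_four_block_mat[of _ 1 1 _ m _ m _ _ 1 _ m]) auto
  also have "A2 * V * mat_adjoint V = A2"
    using sb(2) Vc Va VV by (simp add: assoc_mult_mat[of _ 1 m _ m _ m])
  also have "four_block_mat A1 A2 (0\<^sub>m m 1) A3 = B" using sb A0 by simp
  finally have eqB: "V' * T' * mat_adjoint V' = B" .
  note V'ac = mat_adjoint_carrier[OF V'c]
  have "W * V' * T' * mat_adjoint (W * V') = W * (V' * T' * mat_adjoint V') * mat_adjoint W"
    using Wc Wa V'c V'ac T'c
    by (simp add: mat_adjoint_mult[OF Wc V'c] assoc_mult_mat[of _ ?n ?n _ ?n _ ?n])
  also have "\<dots> = (W * mat_adjoint W) * A * (W * mat_adjoint W)"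
    unfolding eqB unfolding B_def using Wc Wa A by (simp add: assoc_mult_mat[of _ ?n ?n _ ?n _ ?n])
  also have "\<dots> = A" unfolding WW using A by simp
  finally have "A = W * V' * T' * mat_adjoint (W * V')" ..
  moreover have "upper_triangular A1" using sb(1) by (auto simp: upper_triangular_def)
  hence "upper_triangular T'"
    unfolding T'_def using sb T by (intro upper_triangular_four_block) auto
  ultimately show ?case using unitary_mat_mult[OF W uV'] T'c by blast
qed

section \<open>Coefficients of the adjugate trace polynomial\<close>

lemma coeff_prod_linear_factors:
  fixes as :: "'a :: idom list"
  shows "coeff (\<Prod>a\<leftarrow>as. [:- a, 1:]) (length as) = 1"
    and "length as = Suc k \<Longrightarrow> coeff (\<Prod>a\<leftarrow>as. [:- a, 1:]) k = - sum_list as"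
proof -
  have deg: "degree (\<Prod>a\<leftarrow>as. [:- a, 1:]) = length as" for as :: "'a list"
    by (rule degree_linear_factors)
  show lead: "coeff (\<Prod>a\<leftarrow>as. [:- a, 1:]) (length as) = 1" for as :: "'a list"
    by (induction as) (auto simp: coeff_eq_0 deg)
  show "length as = Suc k \<Longrightarrow> coeff (\<Prod>a\<leftarrow>as. [:- a, 1:]) k = - sum_list as"
  proof (induction as arbitrary: k)
    case (Cons a as)
    show ?case
    proof (cases k)
      case 0
      with Cons show ?thesis by simp
    next
      case (Suc l)
      with Cons lead[of as] show ?thesis by simp
    qed
  qed simp
qed

text \<open>Over the complex numbers \<open>p\<close> splits into linear factors, whose roots with
  multiplicity are exactly \<open>proots p\<close>; the two top coefficients of the product then
  give the sum.\<close>

lemma sum_proots_complex: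
  fixes p :: "complex poly"
  assumes "degree p = Suc k"
  shows "(\<Sum>x\<in>#proots p. x) = - coeff p k / coeff p (Suc k)"
proof -
  obtain as where as: "smult (lead_coeff p) (\<Prod>a\<leftarrow>as. [:- a, 1:]) = p" "length as = degree p"
    using fundamental_theorem_algebra_factorized[of p] by blast
  have lc: "lead_coeff p \<noteq> 0" using assms unfolding leading_coeff_0_iff by auto
  have "proots (\<Prod>a\<leftarrow>as. [:- a, 1:]) = mset as"
  proof (induction as)
    case (Cons a as)
    have "(\<Prod>a\<leftarrow>as. [:- a, 1:]) \<noteq> 0" using coeff_prod_linear_factors(1)[of as] by auto
    thus ?case using Cons by (simp add: proots_mult del: mult_pCons_left)
  qed simp
  hence "proots p = mset as" using as(1) lc proots_smult by metis
  hence "(\<Sum>x\<in>#proots p. x) = sum_list as" by (simp add: sum_mset_sum_list)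
  moreover have "coeff p k = coeff p (Suc k) * - sum_list as"
    using coeff_prod_linear_factors(2)[of as k] as assms coeff_smult by metis
  ultimately show ?thesis using lc assms by (simp add: field_simps)
qed

text \<open>The secondary polynomial with an arbitrary matrix \<open>M\<close> in the second factor.
  This generality is needed because the recursion below replaces \<open>M\<close> by
  \<open>A * M\<close>, which need not have the form \<open>mat_adjoint A - B\<close>.\<close>

definition adj_trace_poly :: "complex mat \<Rightarrow> complex mat \<Rightarrow> complex poly" where
  "adj_trace_poly A M = mat_trace (adj_mat (char_poly_matrix A) * map_mat (\<lambda>c. [:c:]) M)"

lemma adj_trace_poly_sum:
  assumes A: "A \<in> carrier_mat n n" and M: "M \<in> carrier_mat n n"
  shows "adj_trace_poly A M =
    (\<Sum>i<n. \<Sum>j<n. smult (M $$ (j, i)) (adj_mat (char_poly_matrix A) $$ (i, j)))"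
proof -
  have "char_poly_matrix A \<in> carrier_mat n n" using A by simp
  note adj_mat(1)[OF this]
  thus ?thesis using M
    by (auto simp: adj_trace_poly_def mat_trace_def scalar_prod_def lessThan_atLeast0 intro!: sum.cong)
qed

text \<open>From \<open>adj (x I - A) (x I - A) = \<chi>(x) I\<close>, where \<open>\<chi>\<close> is the characteristic polynomial.\<close>

lemma adj_trace_poly_recursion:
  assumes A: "A \<in> carrier_mat n n" and M: "M \<in> carrier_mat n n"
  shows "pCons 0 (adj_trace_poly A M) = smult (mat_trace M) (char_poly A) + adj_trace_poly A (A * M)"
proof -
  let ?C = "char_poly_matrix A"
  define J where "J = adj_mat ?C"
  have C: "?C \<in> carrier_mat n n" using A by simp
  note adj = adj_mat[OF C, folded J_def]
  \<comment> \<open>Entrywise form of x J = \<chi>(x) I + J A, where \<open>pCons 0\<close> is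
    multiplication by x.\<close>
  have step: "pCons 0 (J $$ (i, j)) =
      (if i = j then char_poly A else 0) + (\<Sum>k<n. smult (A $$ (k, j)) (J $$ (i, k)))"
    if ij: "i < n" "j < n" for i j
  proof -
    have "(\<Sum>k<n. J $$ (i, k) * ?C $$ (k, j)) = (J * ?C) $$ (i, j)"
      using ij adj(1) C by (auto simp: scalar_prod_def lessThan_atLeast0)
    also have "\<dots> = (if i = j then char_poly A else 0)"
      unfolding adj(3) using ij by (auto simp: char_poly_def)
    finally have "(if i = j then char_poly A else 0) = (\<Sum>k<n. J $$ (i, k) * ?C $$ (k, j))" ..
    also have "\<dots> = (\<Sum>k<n. (if k = j then pCons 0 (J $$ (i, k)) else 0) - smult (A $$ (k, j)) (J $$ (i, k)))"
      using ij A by (intro sum.cong) (auto simp: char_poly_matrix_def algebra_simps)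
    also have "\<dots> = pCons 0 (J $$ (i, j)) - (\<Sum>k<n. smult (A $$ (k, j)) (J $$ (i, k)))"
      using ij by (simp add: sum_subtractf)
    finally show ?thesis by (simp add: algebra_simps)
  qed
  have pCons_sum: "pCons 0 (sum f S) = (\<Sum>x\<in>S. pCons 0 (f x))"
    for f :: "nat \<Rightarrow> complex poly" and S
    by (rule poly_eqI) (auto simp: coeff_sum coeff_pCons split: nat.split)
  have "pCons 0 (adj_trace_poly A M) = (\<Sum>i<n. \<Sum>j<n. smult (M $$ (j, i)) (pCons 0 (J $$ (i, j))))"
    unfolding adj_trace_poly_sum[OF A M] J_def[symmetric] by (simp add: pCons_sum)
  also have "\<dots> = (\<Sum>i<n. \<Sum>j<n. (if i = j then smult (M $$ (j, i)) (char_poly A) else 0) +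
      (\<Sum>k<n. smult (M $$ (j, i) * A $$ (k, j)) (J $$ (i, k))))"
    by (intro sum.cong refl) (auto simp: step smult_add_right smult_sum2)
  also have "\<dots> = (\<Sum>i<n. smult (M $$ (i, i)) (char_poly A)) +
      (\<Sum>i<n. \<Sum>j<n. \<Sum>k<n. smult (M $$ (j, i) * A $$ (k, j)) (J $$ (i, k)))"
    by (simp add: sum.distrib)
  also have "(\<Sum>i<n. smult (M $$ (i, i)) (char_poly A)) = smult (mat_trace M) (char_poly A)"
    using M by (simp add: mat_trace_def smult_sum)
  also have "(\<Sum>i<n. \<Sum>j<n. \<Sum>k<n. smult (M $$ (j, i) * A $$ (k, j)) (J $$ (i, k))) =
      (\<Sum>i<n. \<Sum>k<n. \<Sum>j<n. smult (M $$ (j, i) * A $$ (k, j)) (J $$ (i, k)))"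
    by (rule sum.cong[OF refl], rule sum.swap)
  also have "\<dots> = adj_trace_poly A (A * M)"
    using A M unfolding adj_trace_poly_sum[OF A mult_carrier_mat[OF A M]] J_def[symmetric]
    by (auto simp: scalar_prod_def smult_sum lessThan_atLeast0 mult.commute intro!: sum.cong)
  finally show ?thesis .
qed

text \<open>Comparison of the coefficients of x^(k+1) in the recursion. It moves from index k to k +
  1 at the cost of a factor \<open>A\<close>, so the top coefficients can be computed one after the
  other.\<close>

lemma coeff_adj_trace_poly:
  assumes "A \<in> carrier_mat n n" "M \<in> carrier_mat n n"
  shows "coeff (adj_trace_poly A M) k =
    mat_trace M * coeff (char_poly A) (Suc k) + coeff (adj_trace_poly A (A * M)) (Suc k)"
  using arg_cong[OF adj_trace_poly_recursion[OF assms], of "\<lambda>p. coeff p (Suc k)"] by simp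

text \<open>The recursion is read downwards: from degree n + 1 on, the characteristic polynomial
  contributes nothing, so a zero at k + 1 for \<open>A * M\<close> yields a zero at k for
  \<open>M\<close>. The descent starts beyond the degrees of all entries of the adjugate.\<close>

lemma coeff_adj_trace_poly_eq_0:
  assumes A: "A \<in> carrier_mat n n" and M: "M \<in> carrier_mat n n" and "n \<le> k"
  shows "coeff (adj_trace_poly A M) k = 0"
proof -
  define J where "J = adj_mat (char_poly_matrix A)"
  \<comment> \<open>A crude bound on all degrees in \<open>J\<close>. It does not depend on
    \<open>M\<close>, which changes to \<open>A * M\<close> along the induction.\<close>
  define K where "K = (\<Sum>i<n. \<Sum>j<n. degree (J $$ (i, j)))"
  have deg: "degree (J $$ (i, j)) \<le> K" if "i < n" "j < n" for i j
  proof -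
    have "degree (J $$ (i, j)) \<le> (\<Sum>j<n. degree (J $$ (i, j)))"
      using that by (intro member_le_sum) auto
    also have "\<dots> \<le> K" unfolding K_def using that by (intro member_le_sum) auto
    finally show ?thesis .
  qed
  have "coeff (adj_trace_poly A M) k = 0" if "k \<le> max k (Suc K)" "n \<le> k" for k
    using that M
  proof (induction k arbitrary: M rule: inc_induct)
    case base
    have "coeff (J $$ (i, j)) (max k (Suc K)) = 0" if "i < n" "j < n" for i j
      using deg[OF that] by (intro coeff_eq_0) simp
    thus ?case
      unfolding adj_trace_poly_sum[OF A base(2)] J_def[symmetric] by (simp add: coeff_sum)
  next
    case (step l)
    have "coeff (char_poly A) (Suc l) = 0"
      using step degree_monic_char_poly[OF A] by (intro coeff_eq_0) simp
    moreover have "coeff (adj_trace_poly A (A * M)) (Suc l) = 0"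
      using step.IH[of "A * M"] step A by simp
    ultimately show ?case using coeff_adj_trace_poly[OF A step(5)] by simp
  qed
  thus ?thesis using \<open>n \<le> k\<close> by simp
qed

section \<open>Traces against a bar operation\<close>

lemma mat_trace_mult_comm:
  fixes A B :: "complex mat"
  assumes "A \<in> carrier_mat n m" "B \<in> carrier_mat m n"
  shows "mat_trace (A * B) = mat_trace (B * A)"
proof -
  have "mat_trace (A * B) = (\<Sum>i<n. \<Sum>j<m. A $$ (i, j) * B $$ (j, i))"
    using assms by (auto simp: mat_trace_def scalar_prod_def lessThan_atLeast0)
  also have "\<dots> = (\<Sum>j<m. \<Sum>i<n. A $$ (i, j) * B $$ (j, i))"
    by (rule sum.swap)
  also have "\<dots> = mat_trace (B * A)"
    using assms by (auto simp: mat_trace_def scalar_prod_def lessThan_atLeast0 mult.commute)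
  finally show ?thesis .
qed

lemma mat_trace_diff:
  fixes A B :: "complex mat"
  assumes "A \<in> carrier_mat n n" "B \<in> carrier_mat n n"
  shows "mat_trace (A - B) = mat_trace A - mat_trace B"
  using assms by (simp add: mat_trace_def sum_subtractf)

lemma mat_trace_similar:
  fixes R :: "complex mat"
  assumes "R \<in> carrier_mat n n" "P \<in> carrier_mat n n" "Q \<in> carrier_mat n n" "Q * P = 1\<^sub>m n"
  shows "mat_trace (P * R * Q) = mat_trace R"
proof -
  have "mat_trace (P * R * Q) = mat_trace (Q * (P * R))"
    using assms by (intro mat_trace_mult_comm[of _ n n]) auto
  also have "Q * (P * R) = Q * P * R"
    by (rule assoc_mult_mat[symmetric]) (use assms in auto)
  finally show ?thesis using assms by simp
qed

lemma unitary_similar_mat: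
  assumes "unitary_mat n U" "T \<in> carrier_mat n n"
  shows "similar_mat (U * T * mat_adjoint U) T"
proof -
  have "similar_mat_wit (U * T * mat_adjoint U) T U (mat_adjoint U)"
    using assms mat_adjoint_carrier[of U n]
    unfolding unitary_mat_def by (intro similar_mat_witI[of _ _ n] mult_carrier_mat[of _ n n]) auto
  thus ?thesis unfolding similar_mat_def by blast
qed

text \<open>Both sides are invariant under similarity, and for a triangular matrix both are read off
  the diagonal.\<close>

lemma coeff_char_poly_mat_trace:
  fixes A :: "complex mat"
  assumes A: "A \<in> carrier_mat n n" and "n = Suc k"
  shows "coeff (char_poly A) k = - mat_trace A"
proof -
  obtain U T where U: "unitary_mat n U" and T: "T \<in> carrier_mat n n" "upper_triangular T"
    and A: "A = U * T * mat_adjoint U"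
    using unitary_schur[OF A] by blast
  have "mat_trace A = mat_trace T"
    unfolding A using U T mat_adjoint_carrier[of U n]
    by (intro mat_trace_similar[of _ n]) (auto simp: unitary_mat_def)
  also have "\<dots> = sum_list (diag_mat T)"
    using T by (simp add: mat_trace_def diag_mat_def sum_list_sum_nth lessThan_atLeast0)
  finally have "mat_trace A = sum_list (diag_mat T)" .
  moreover have "char_poly A = (\<Prod>a\<leftarrow>diag_mat T. [:- a, 1:])"
    using char_poly_similar[OF unitary_similar_mat[OF U T(1)]] char_poly_upper_triangular[OF T]
    unfolding A by simp
  moreover have "length (diag_mat T) = Suc k" using T assms(2) by (simp add: diag_mat_def)
  ultimately show ?thesis using coeff_prod_linear_factors(2) by metis
qed

text \<open>The trace is the sum of the diagonal entries of a triangularization, all of which are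
  eigenvalues. This serves to show that certain products have trace zero without exhibiting a
  vanishing power.\<close>

lemma mat_trace_eq_0:
  fixes F :: "complex mat"
  assumes F: "F \<in> carrier_mat n n" and ev: "\<And>\<nu>. eigenvalue F \<nu> \<Longrightarrow> \<nu> = 0"
  shows "mat_trace F = 0"
proof -
  obtain U T where U: "unitary_mat n U" and T: "T \<in> carrier_mat n n" "upper_triangular T"
    and FU: "F = U * T * mat_adjoint U"
    using unitary_schur[OF F] by blast
  have "char_poly F = (\<Prod>a\<leftarrow>diag_mat T. [:- a, 1:])"
    using char_poly_similar[OF unitary_similar_mat[OF U T(1)]] char_poly_upper_triangular[OF T]
    unfolding FU by simp
  hence "T $$ (i, i) = 0" if "i < n" for i
    using that T by (intro ev) (auto simp: eigenvalue_root_char_poly[OF F] poly_prod_list prod_list_zero_iff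
        diag_mat_def image_iff)
  hence "mat_trace T = 0" using T by (simp add: mat_trace_def)
  moreover have "mat_trace F = mat_trace T"
    unfolding FU using U T mat_adjoint_carrier[of U n]
    by (intro mat_trace_similar[of _ n]) (auto simp: unitary_mat_def)
  ultimately show ?thesis by simp
qed

text \<open>An eigenspace of \<open>F\<close> is invariant under \<open>T\<close>; a nonzero vector in it whose last nonzero
  entry has the least possible index is an eigenvector of \<open>T\<close>.\<close>

lemma commuting_upper_triangular_eigenvector:
  fixes F T :: "complex mat"
  assumes T: "T \<in> carrier_mat n n" "upper_triangular T" and F: "F \<in> carrier_mat n n"
    and comm: "F * T = T * F" and ev: "eigenvalue F \<nu>"
  obtains u m where "u \<in> carrier_vec n" "u \<noteq> 0\<^sub>v n" "F *\<^sub>v u = \<nu> \<cdot>\<^sub>v u"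
    "m < n" "T *\<^sub>v u = T $$ (m, m) \<cdot>\<^sub>v u"
proof -
  define P where "P k \<longleftrightarrow> (\<exists>v. v \<in> carrier_vec n \<and> v \<noteq> 0\<^sub>v n \<and> F *\<^sub>v v = \<nu> \<cdot>\<^sub>v v \<and>
    (\<forall>i<n. k \<le> i \<longrightarrow> v $ i = 0))" for k
  have "P n" using ev F by (auto simp: P_def eigenvalue_def eigenvector_def)
  define k where "k = (LEAST k. P k)"
  have "P k" and least: "\<And>l. P l \<Longrightarrow> k \<le> l" and "k \<le> n"
    unfolding k_def using \<open>P n\<close> by (auto intro: LeastI Least_le)
  then obtain v where v: "v \<in> carrier_vec n" "v \<noteq> 0\<^sub>v n" "F *\<^sub>v v = \<nu> \<cdot>\<^sub>v v"
    and zero: "\<And>i. i < n \<Longrightarrow> k \<le> i \<Longrightarrow> v $ i = 0"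
    unfolding P_def by blast
  have "k \<noteq> 0"
  proof
    assume "k = 0"
    hence "v = 0\<^sub>v n" using zero v by (intro eq_vecI) auto
    with v show False by simp
  qed
  \<comment> \<open>Entries of \<open>v\<close> vanish from index \<open>k\<close> on, so by
    minimality of \<open>k\<close> the last nonzero one sits at \<open>m\<close>, one below
    \<open>k\<close>.\<close>
  then obtain m where m: "k = Suc m" by (cases k) auto
  \<comment> \<open>Since \<open>F\<close> and \<open>T\<close> commute, \<open>w\<close> stays in
    the eigenspace of \<open>F\<close>. Triangularity makes its entries vanish from \<open>m\<close>
    on, so minimality of \<open>k\<close> forces \<open>w\<close> to be zero, which says that
    \<open>v\<close> is an eigenvector of \<open>T\<close>.\<close>
  define w where "w = T *\<^sub>v v - T $$ (m, m) \<cdot>\<^sub>v v"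
  have w: "w \<in> carrier_vec n" using T v by (auto simp: w_def)
  have "F *\<^sub>v w = F *\<^sub>v (T *\<^sub>v v) - T $$ (m, m) \<cdot>\<^sub>v (F *\<^sub>v v)"
    unfolding w_def using T v F
    by (simp add: mult_minus_distrib_mat_vec[of _ n n] mult_mat_vec[of _ n n])
  also have "F *\<^sub>v (T *\<^sub>v v) = T *\<^sub>v (F *\<^sub>v v)"
    using T F v comm assoc_mult_mat_vec[OF F T(1) v(1)] assoc_mult_mat_vec[OF T(1) F v(1)] by simp
  also have "T *\<^sub>v (F *\<^sub>v v) - T $$ (m, m) \<cdot>\<^sub>v (F *\<^sub>v v) = \<nu> \<cdot>\<^sub>v w"
    unfolding v(3) w_def using T v
    by (intro eq_vecI) (auto simp: mult_mat_vec[of _ n n] algebra_simps)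
  finally have Fw: "F *\<^sub>v w = \<nu> \<cdot>\<^sub>v w" .
  have "w $ i = 0" if i: "i < n" "m \<le> i" for i
  proof -
    have "(T *\<^sub>v v) $ i = (\<Sum>j<n. T $$ (i, j) * v $ j)"
      using T v i by (auto simp: scalar_prod_def lessThan_atLeast0)
    also have "\<dots> = (\<Sum>j<n. if j = i then T $$ (i, i) * v $ i else 0)"
    proof (intro sum.cong refl)
      fix j assume "j \<in> {..<n}"
      hence "j < n" by simp
      consider "j < i" | "j = i" | "j > i" by linarith
      thus "T $$ (i, j) * v $ j = (if j = i then T $$ (i, i) * v $ i else 0)"
      proof cases
        case 1
        hence "T $$ (i, j) = 0" using T i by (auto simp: upper_triangular_def)
        thus ?thesis using 1 by simp
      next
        case 3
        thus ?thesis using zero[OF \<open>j < n\<close>] i m by simp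
      qed simp
    qed
    also have "\<dots> = T $$ (i, i) * v $ i" using i by simp
    also have "\<dots> = T $$ (m, m) * v $ i"
      using zero[OF i(1)] i m by (cases "i = m") auto
    finally show ?thesis using v T i by (simp add: w_def)
  qed
  hence "P m" if "w \<noteq> 0\<^sub>v n" unfolding P_def using that w Fw by blast
  hence "w = 0\<^sub>v n" using least[of m] m by fastforce
  have "T *\<^sub>v v = T $$ (m, m) \<cdot>\<^sub>v v"
  proof (intro eq_vecI)
    fix i assume "i < dim_vec (T $$ (m, m) \<cdot>\<^sub>v v)"
    hence "i < n" using v by simp
    thus "(T *\<^sub>v v) $ i = (T $$ (m, m) \<cdot>\<^sub>v v) $ i"
      using arg_cong[OF \<open>w = 0\<^sub>v n\<close>, of "\<lambda>w. w $ i"] v T by (simp add: w_def)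
  qed (use v T in auto)
  thus thesis using v m \<open>k \<le> n\<close> by (intro that[of v m]) auto
qed

section \<open>Products and polynomials of triangular matrices\<close>

lemma upper_triangular_mult:
  fixes X Y :: "complex mat"
  assumes X: "X \<in> carrier_mat n n" "upper_triangular X" and Y: "Y \<in> carrier_mat n n" "upper_triangular Y"
  shows "upper_triangular (X * Y)"
    and "i < n \<Longrightarrow> (X * Y) $$ (i, i) = X $$ (i, i) * Y $$ (i, i)"
proof -
  have entry: "(X * Y) $$ (i, j) = (\<Sum>k<n. X $$ (i, k) * Y $$ (k, j))" if "i < n" "j < n" for i j
    using that X Y by (auto simp: scalar_prod_def lessThan_atLeast0)
  have z: "X $$ (i, k) * Y $$ (k, j) = 0" if "i < n" "k < n" "k < i \<or> j < k" for i j k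
    using that X Y by (auto simp: upper_triangular_def)
  have "(X * Y) $$ (i, j) = 0" if "i < n" "j < i" for i j
  proof -
    have "j < n" using that by simp
    have "X $$ (i, k) * Y $$ (k, j) = 0" if "k < n" for k
      using z[OF \<open>i < n\<close> \<open>k < n\<close>, of j] \<open>j < i\<close> by linarith
    thus ?thesis unfolding entry[OF \<open>i < n\<close> \<open>j < n\<close>] by (intro sum.neutral) auto
  qed
  thus "upper_triangular (X * Y)" using X by (auto simp: upper_triangular_def)
  show "(X * Y) $$ (i, i) = X $$ (i, i) * Y $$ (i, i)" if i: "i < n"
  proof -
    have "(X * Y) $$ (i, i) = (\<Sum>k<n. if k = i then X $$ (i, i) * Y $$ (i, i) else 0)"
      unfolding entry[OF i i]
    proof (intro sum.cong refl)
      fix k assume "k \<in> {..<n}"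
      thus "X $$ (i, k) * Y $$ (k, i) = (if k = i then X $$ (i, i) * Y $$ (i, i) else 0)"
        using z[OF i, of k i] by (cases k i rule: linorder_cases) auto
    qed
    thus ?thesis using i by simp
  qed
qed

lemma eval_mat_upper_triangular:
  assumes T: "T \<in> carrier_mat n n" "upper_triangular T"
  shows "upper_triangular (eval_mat n cs T)"
    and "i < n \<Longrightarrow> eval_mat n cs T $$ (i, i) = poly (Poly cs) (T $$ (i, i))"
proof (induction cs)
  case (Cons c cs)
  note E = eval_mat_carrier[OF T(1), of cs]
  note tm = upper_triangular_mult[OF T E]
  {
    case 1
    from tm(1)[OF Cons(1)] show ?case using T E by (auto simp: upper_triangular_def)
  next
    case 2
    thus ?case using tm(2)[OF Cons(1), of i] Cons(2) T E by auto
  }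
qed (auto simp: upper_triangular_def)

text \<open>If \<open>E\<close> is the difference of \<open>B\<close> and a polynomial in \<open>T\<close> interpolating conjugation on the
  spectrum, then every eigenvector of \<open>T\<close> lies in the kernel of \<open>E\<close>, so that \<open>M E\<close> is nilpotent.\<close>

lemma mat_trace_mult_bar:
  fixes T B M :: "complex mat"
  assumes T: "T \<in> carrier_mat n n" "upper_triangular T"
    and B: "B \<in> carrier_mat n n" "B * T = T * B"
    and Bev: "\<And>u \<mu>. eigenvector T u \<mu> \<Longrightarrow> B *\<^sub>v u = cnj \<mu> \<cdot>\<^sub>v u"
    and M: "M \<in> carrier_mat n n" "upper_triangular M" "M * T = T * M"
  shows "mat_trace (M * B) = (\<Sum>i<n. M $$ (i, i) * cnj (T $$ (i, i)))"
proof -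
  obtain p where p: "\<And>i. i < n \<Longrightarrow> poly p (T $$ (i, i)) = cnj (T $$ (i, i))"
    using interpolation_exists[of "(\<lambda>i. T $$ (i, i)) ` {..<n}" cnj] by auto
  define G where "G = eval_mat n (coeffs p) T"
  have G: "G \<in> carrier_mat n n" "upper_triangular G" "G * T = T * G"
    unfolding G_def using T
    by (auto simp: eval_mat_carrier eval_mat_upper_triangular eval_mat_commute)
  define E where "E = B - G"
  have E: "E \<in> carrier_mat n n" using B G by (auto simp: E_def)
  have ET: "E * T = T * E"
    unfolding E_def using B G T
    by (simp add: minus_mult_distrib_mat[of _ n n] mult_minus_distrib_mat[of _ n n])
  define F where "F = M * E"
  have F: "F \<in> carrier_mat n n" using M E by (auto simp: F_def)
  have "F * T = M * (E * T)"
    unfolding F_def by (rule assoc_mult_mat[OF M(1) E T(1)])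
  also have "\<dots> = M * T * E"
    unfolding ET by (rule assoc_mult_mat[OF M(1) T(1) E, symmetric])
  also have "\<dots> = T * F"
    unfolding M(3) F_def by (rule assoc_mult_mat[OF T(1) M(1) E])
  finally have comm: "F * T = T * F" .
  have "mat_trace F = 0"
  proof (rule mat_trace_eq_0[OF F])
    fix \<nu> assume "eigenvalue F \<nu>"
    \<comment> \<open>\<open>F\<close> commutes with \<open>T\<close>, so each eigenvalue of
      \<open>F\<close> has an eigenvector shared with \<open>T\<close>. There \<open>B\<close> and
      \<open>G\<close> both act as the conjugated eigenvalue of \<open>T\<close>, hence
      \<open>E\<close> and \<open>F\<close> vanish on it.\<close>
    then obtain u m where u: "u \<in> carrier_vec n" "u \<noteq> 0\<^sub>v n" "F *\<^sub>v u = \<nu> \<cdot>\<^sub>v u"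
      and m: "m < n" "T *\<^sub>v u = T $$ (m, m) \<cdot>\<^sub>v u"
      using commuting_upper_triangular_eigenvector[OF T F comm] by metis
    have "B *\<^sub>v u = cnj (T $$ (m, m)) \<cdot>\<^sub>v u"
      using u m T by (intro Bev) (auto simp: eigenvector_def)
    moreover have "G *\<^sub>v u = cnj (T $$ (m, m)) \<cdot>\<^sub>v u"
      unfolding G_def using eval_mat_eigenvector[OF T(1) u(1) m(2), of "coeffs p"] p[OF m(1)] by simp
    ultimately have Eu: "E *\<^sub>v u = 0\<^sub>v n"
      unfolding E_def using B G u by (simp add: minus_mult_distrib_mat_vec[of _ n n])
    hence "F *\<^sub>v u = 0\<^sub>v n"
      unfolding F_def assoc_mult_mat_vec[OF M(1) E u(1)] Eu using M by (intro eq_vecI) auto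
    hence z: "\<nu> \<cdot>\<^sub>v u = 0\<^sub>v n" using u by simp
    obtain i where "i < n" "u $ i \<noteq> 0" using u by (metis eq_vecI carrier_vecD index_zero_vec)
    with arg_cong[OF z, of "\<lambda>w. w $ i"] u show "\<nu> = 0" by simp
  qed
  moreover have "F = M * B - M * G"
    unfolding F_def E_def using M B G by (simp add: mult_minus_distrib_mat[of _ n n])
  ultimately have "mat_trace (M * B) = mat_trace (M * G)"
    using M B G mat_trace_diff[of "M * B" n "M * G"] by simp
  \<comment> \<open>With \<open>B\<close> replaced by \<open>G\<close>, both factors are triangular
    and the trace of the product sees only their diagonals.\<close>
  also have "\<dots> = (\<Sum>i<n. M $$ (i, i) * G $$ (i, i))"
    using M G upper_triangular_mult(2)[OF M(1,2) G(1,2)] by (simp add: mat_trace_def)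
  also have "\<dots> = (\<Sum>i<n. M $$ (i, i) * cnj (T $$ (i, i)))"
    unfolding G_def by (intro sum.cong) (auto simp: eval_mat_upper_triangular(2)[OF T] p)
  finally show ?thesis .
qed

section \<open>Convexity of the numerical range\<close>

lemma quadratic_form_combination:
  fixes A :: "complex mat"
  assumes A: "A \<in> carrier_mat n n" and u: "u \<in> carrier_vec n" and v: "v \<in> carrier_vec n"
  shows "(A *\<^sub>v (p \<cdot>\<^sub>v u + r \<cdot>\<^sub>v v)) \<bullet>c (p \<cdot>\<^sub>v u + r \<cdot>\<^sub>v v) =
    p * cnj p * ((A *\<^sub>v u) \<bullet>c u) + p * cnj r * ((A *\<^sub>v u) \<bullet>c v) +
    r * cnj p * ((A *\<^sub>v v) \<bullet>c u) + r * cnj r * ((A *\<^sub>v v) \<bullet>c v)"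
proof -
  have "A *\<^sub>v (p \<cdot>\<^sub>v u + r \<cdot>\<^sub>v v) = p \<cdot>\<^sub>v (A *\<^sub>v u) + r \<cdot>\<^sub>v (A *\<^sub>v v)"
    using A u v by (simp add: mult_add_distrib_mat_vec[of _ n n] mult_mat_vec[of _ n n])
  thus ?thesis
    using A u v
    by (simp add: scalar_prod_conj_sum algebra_simps sum.distrib sum_distrib_left)
qed

lemma cscalar_prod_self_real:
  fixes v :: "complex vec"
  shows "v \<bullet>c v = of_real (Re (v \<bullet>c v))"
  by (simp add: scalar_prod_conj_sum complex_eq_iff)

lemma cscalar_prod_self_pos:
  fixes v :: "complex vec"
  assumes "v \<in> carrier_vec n"
  shows "Re (v \<bullet>c v) \<ge> 0" and "v \<noteq> 0\<^sub>v n \<Longrightarrow> Re (v \<bullet>c v) > 0"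
proof -
  show *: "Re (v \<bullet>c v) \<ge> 0"
    by (auto simp: scalar_prod_conj_sum intro!: sum_nonneg add_nonneg_nonneg)
  show "Re (v \<bullet>c v) > 0" if "v \<noteq> 0\<^sub>v n"
  proof -
    have "v \<bullet>c v \<noteq> 0" using assms that by simp
    hence "Re (v \<bullet>c v) \<noteq> 0" using cscalar_prod_self_real[of v] by (metis of_real_0)
    with * show ?thesis by simp
  qed
qed

lemma numerical_rangeI:
  assumes "A \<in> carrier_mat n n" "w \<in> carrier_vec n" "w \<noteq> 0\<^sub>v n" "(A *\<^sub>v w) \<bullet>c w = z * (w \<bullet>c w)"
  shows "z \<in> numerical_range A"
  unfolding numerical_range_def using assms by (auto intro!: exI[of _ w])

lemma numerical_rangeE:
  assumes "A \<in> carrier_mat n n" "z \<in> numerical_range A"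
  obtains w where "w \<in> carrier_vec n" "w \<noteq> 0\<^sub>v n" "(A *\<^sub>v w) \<bullet>c w = z * (w \<bullet>c w)"
  using assms unfolding numerical_range_def by auto

text \<open>After the affine normalisation \<open>f\<close>, the values at \<open>u\<close> and \<open>v\<close> are 0 and 1. Rotating \<open>v\<close>
  by a suitable phase \<open>c\<close> makes \<open>f\<close> real on the segment from \<open>u\<close> to \<open>c v\<close>, so that the
  intermediate value theorem applies.\<close>

theorem toeplitz_hausdorff:
  fixes A :: "complex mat"
  assumes A: "A \<in> carrier_mat n n"
  shows "convex (numerical_range A)"
proof (rule convexI)
  fix a b :: complex and l s :: real
  assume a: "a \<in> numerical_range A" and b: "b \<in> numerical_range A"
    and l: "0 \<le> l" "0 \<le> s" "l + s = 1"
  show "l *\<^sub>R a + s *\<^sub>R b \<in> numerical_range A"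
  proof (cases "a = b")
    case True
    hence "l *\<^sub>R a + s *\<^sub>R b = a" using l by (simp flip: scaleR_add_left)
    thus ?thesis using a by simp
  next
    case False
    obtain u where u: "u \<in> carrier_vec n" "u \<noteq> 0\<^sub>v n" "(A *\<^sub>v u) \<bullet>c u = a * (u \<bullet>c u)"
      using numerical_rangeE[OF A a] by blast
    obtain v where v: "v \<in> carrier_vec n" "v \<noteq> 0\<^sub>v n" "(A *\<^sub>v v) \<bullet>c v = b * (v \<bullet>c v)"
      using numerical_rangeE[OF A b] by blast
    \<comment> \<open>\<open>h\<close> is the sesquilinear form of the matrix (A - a I) / (b -
      a).\<close>
    define h where "h x y = ((A *\<^sub>v x) \<bullet>c y - a * (x \<bullet>c y)) / (b - a)" for x y
    define f where "f x = h x x" for x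
    have hu: "h u u = 0" and hv: "h v v = v \<bullet>c v"
      using u v False by (simp_all add: h_def field_simps)
    have f: "f (p \<cdot>\<^sub>v u + r \<cdot>\<^sub>v v) = p * cnj r * h u v + r * cnj p * h v u + r * cnj r * (v \<bullet>c v)" for p r
    proof -
      have "f (p \<cdot>\<^sub>v u + r \<cdot>\<^sub>v v) =
          p * cnj p * h u u + p * cnj r * h u v + r * cnj p * h v u + r * cnj r * h v v"
        using quadratic_form_combination[OF A u(1) v(1), of p r]
          quadratic_form_combination[OF one_carrier_mat[of n] u(1) v(1), of p r] u(1) v(1)
        by (simp add: f_def h_def add_divide_distrib diff_divide_distrib algebra_simps)
      thus ?thesis by (simp add: hu hv)
    qed
    \<comment> \<open>The cross terms of \<open>f\<close> along the segment add up to a real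
      multiple of \<open>R\<close>. As \<open>cnj c * h u v\<close> has the same imaginary part as -
      c times the conjugate of \<open>h u v\<close>, the imaginary part of \<open>R\<close> is that
      of \<open>c * \<gamma>\<close>; the phase \<open>c\<close> turns this product into the modulus
      of \<open>\<gamma>\<close>.\<close>
    define \<gamma> where "\<gamma> = h v u - cnj (h u v)"
    define c where "c = (if \<gamma> = 0 then 1 else cnj \<gamma> / cmod \<gamma>)"
    have "cmod c = 1" by (simp add: c_def norm_divide)
    hence cc: "c * cnj c = 1" by (simp add: complex_mult_cnj cmod_def complex_eq_iff)
    have "c * \<gamma> = cmod \<gamma>"
      by (simp add: c_def mult.commute[of "cnj \<gamma>"] complex_norm_square[symmetric] power2_eq_square)
    hence "Im (c * \<gamma>) = 0" by simp
    define R where "R = cnj c * h u v + c * h v u"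
    have "Im R = Im (c * \<gamma>)" by (simp add: R_def \<gamma>_def algebra_simps)
    then obtain \<rho> where R: "R = complex_of_real \<rho>"
      using \<open>Im (c * \<gamma>) = 0\<close> complex_is_Real_iff Reals_cases by metis
    define w where "w t = complex_of_real (1 - t) \<cdot>\<^sub>v u + (complex_of_real t * c) \<cdot>\<^sub>v v" for t
    have w: "w t \<in> carrier_vec n" for t using u v by (simp add: w_def)
    define V where "V = Re (v \<bullet>c v)"
    have V: "v \<bullet>c v = of_real V" "V > 0"
      using cscalar_prod_self_real cscalar_prod_self_pos(2)[OF v(1,2)] by (auto simp: V_def)
    have fw: "f (w t) = of_real ((1 - t) * t * \<rho> + t\<^sup>2 * V)" for t
    proof -
      have "f (w t) = (1 - t) * t * R + t\<^sup>2 * (c * cnj c) * (v \<bullet>c v)"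
        unfolding w_def f R_def by (simp add: algebra_simps power2_eq_square)
      thus ?thesis unfolding cc V(1) R by simp
    qed
    define N where "N t = Re (w t \<bullet>c w t)" for t
    have N: "w t \<bullet>c w t = of_real (N t)" for t
      unfolding N_def by (rule cscalar_prod_self_real)
    \<comment> \<open>If \<open>w t\<close> vanished for some nonzero t, then \<open>v\<close> would
      be a multiple of \<open>u\<close>. But \<open>f\<close> is zero on multiples of
      \<open>u\<close>, whereas \<open>f v\<close> is the squared length of
      \<open>v\<close>.\<close>
    have w0: "w t \<noteq> 0\<^sub>v n" for t
    proof
      assume z: "w t = 0\<^sub>v n"
      show False
      proof (cases "t = 0")
        case True
        hence "w t = u" using u v by (intro eq_vecI) (auto simp: w_def)
        thus False using z u by simp
      next
        case False
        define d where "d = - complex_of_real (1 - t) / (t * c)"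
        have "c \<noteq> 0" using \<open>cmod c = 1\<close> by auto
        have "v = d \<cdot>\<^sub>v u + 0 \<cdot>\<^sub>v v"
        proof (intro eq_vecI)
          fix i assume "i < dim_vec (d \<cdot>\<^sub>v u + 0 \<cdot>\<^sub>v v)"
          hence "i < n" using u v by simp
          hence "(1 - t) * u $ i + t * c * v $ i = 0"
            using arg_cong[OF z, of "\<lambda>x. x $ i"] u v by (simp add: w_def)
          thus "v $ i = (d \<cdot>\<^sub>v u + 0 \<cdot>\<^sub>v v) $ i"
            using False \<open>c \<noteq> 0\<close> \<open>i < n\<close> u v by (simp add: d_def field_simps add_eq_0_iff2)
        qed (use u v in auto)
        moreover have "f (d \<cdot>\<^sub>v u + 0 \<cdot>\<^sub>v v) = 0" unfolding f by simp
        ultimately have "f v = 0" by metis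
        thus False using hv V by (simp add: f_def)
      qed
    qed
    have Npos: "N t > 0" for t
      unfolding N_def by (rule cscalar_prod_self_pos(2)[OF w w0])
    have N_poly: "N t = (1 - t)\<^sup>2 * Re (u \<bullet>c u) + t * (1 - t) * Re (cnj c * (u \<bullet>c v) + c * (v \<bullet>c u)) + t\<^sup>2 * V" for t
    proof -
      have "w t \<bullet>c w t = of_real ((1 - t)\<^sup>2) * (u \<bullet>c u) +
          of_real (t * (1 - t)) * (cnj c * (u \<bullet>c v) + c * (v \<bullet>c u)) + of_real (t\<^sup>2) * (c * cnj c) * (v \<bullet>c v)"
        using quadratic_form_combination[OF one_carrier_mat[of n] u(1) v(1),
            of "complex_of_real (1 - t)" "complex_of_real t * c"] u(1) v(1)
        unfolding w_def by (simp add: algebra_simps power2_eq_square)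
      thus ?thesis unfolding N_def cc V(1) by simp
    qed
    \<comment> \<open>The Rayleigh quotient at \<open>w t\<close> in the normalised coordinate,
      where a has become 0 and b has become 1; it has to take the value \<open>s\<close>.\<close>
    define \<phi> where "\<phi> t = ((1 - t) * t * \<rho> + t\<^sup>2 * V) / N t" for t
    have "continuous_on {0..1} N"
      by (subst continuous_on_cong[OF refl N_poly]) (auto intro!: continuous_intros)
    moreover have "N t \<noteq> 0" for t using Npos[of t] by simp
    ultimately have "continuous_on {0..1} \<phi>"
      unfolding \<phi>_def by (intro continuous_intros) auto
    moreover have "\<phi> 0 = 0" "\<phi> 1 = 1" using Npos[of 1] by (auto simp: \<phi>_def N_poly)
    ultimately obtain t where "\<phi> t = s"
      using IVT'[of \<phi> 0 s 1] l by auto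
    hence "f (w t) = of_real s * (w t \<bullet>c w t)"
      unfolding fw N using Npos[of t] by (simp add: \<phi>_def field_simps flip: of_real_mult)
    hence "(A *\<^sub>v w t) \<bullet>c w t = (a + s * (b - a)) * (w t \<bullet>c w t)"
      using False by (simp add: f_def h_def field_simps)
    moreover have "l *\<^sub>R a + s *\<^sub>R b = a + s * (b - a)"
    proof -
      have "l = 1 - s" using l by simp
      show ?thesis unfolding \<open>l = 1 - s\<close> by (simp add: scaleR_conv_of_real algebra_simps)
    qed
    ultimately show ?thesis using numerical_rangeI[OF A w w0] by metis
  qed
qed

text \<open>The quotient of the sums is a convex combination of the single Rayleigh quotients, with
  weights proportional to the squared lengths. Zero vectors contribute to neither sum and are
  discarded first.\<close>

lemma numerical_range_sum:
  fixes A :: "complex mat"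
  assumes A: "A \<in> carrier_mat n n" and I: "finite I" and u: "\<And>i. i \<in> I \<Longrightarrow> u i \<in> carrier_vec n"
    and nz: "(\<Sum>i\<in>I. u i \<bullet>c u i) \<noteq> 0"
  shows "(\<Sum>i\<in>I. (A *\<^sub>v u i) \<bullet>c u i) / (\<Sum>i\<in>I. u i \<bullet>c u i) \<in> numerical_range A"
proof -
  define J where "J = {i \<in> I. u i \<noteq> 0\<^sub>v n}"
  define N where "N i = Re (u i \<bullet>c u i)" for i
  have N: "u i \<bullet>c u i = of_real (N i)" for i unfolding N_def by (rule cscalar_prod_self_real)
  have Npos: "N i > 0" if "i \<in> J" for i
    using that u cscalar_prod_self_pos(2) unfolding J_def N_def by blast
  have J: "finite J" using I by (simp add: J_def)
  have S: "(\<Sum>i\<in>I. u i \<bullet>c u i) = of_real (sum N J)"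
    unfolding of_real_sum N[symmetric] using I A by (intro sum.mono_neutral_right) (auto simp: J_def)
  have Q: "(\<Sum>i\<in>I. (A *\<^sub>v u i) \<bullet>c u i) = (\<Sum>i\<in>J. (A *\<^sub>v u i) \<bullet>c u i)"
    using I A by (intro sum.mono_neutral_right) (auto simp: J_def)
  have nz': "sum N J \<noteq> 0" using nz unfolding S by (metis of_real_0)
  moreover have "sum N J \<ge> 0" using Npos by (intro sum_nonneg) (simp add: less_imp_le)
  ultimately have pos: "sum N J > 0" by simp
  have "(\<Sum>i\<in>J. (N i / sum N J) *\<^sub>R ((A *\<^sub>v u i) \<bullet>c u i / (u i \<bullet>c u i))) \<in> numerical_range A"
  proof (rule convex_sum[OF J toeplitz_hausdorff[OF A]])
    show "(\<Sum>i\<in>J. N i / sum N J) = 1" using nz' by (simp flip: sum_divide_distrib)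
    show "0 \<le> N i / sum N J" if "i \<in> J" for i using Npos[OF that] pos by simp
    show "(A *\<^sub>v u i) \<bullet>c u i / (u i \<bullet>c u i) \<in> numerical_range A" if "i \<in> J" for i
      using that u A unfolding J_def numerical_range_def by auto
  qed
  also have "(\<Sum>i\<in>J. (N i / sum N J) *\<^sub>R ((A *\<^sub>v u i) \<bullet>c u i / (u i \<bullet>c u i))) =
      (\<Sum>i\<in>J. ((A *\<^sub>v u i) \<bullet>c u i) / of_real (sum N J))"
  proof (intro sum.cong refl)
    fix i assume "i \<in> J"
    with Npos have "N i \<noteq> 0" by fastforce
    thus "(N i / sum N J) *\<^sub>R ((A *\<^sub>v u i) \<bullet>c u i / (u i \<bullet>c u i)) =
        (A *\<^sub>v u i) \<bullet>c u i / of_real (sum N J)"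
      unfolding N by (simp add: scaleR_conv_of_real)
  qed
  finally show ?thesis unfolding Q S by (simp add: sum_divide_distrib)
qed

section \<open>Triples of indices in a triangular matrix\<close>

text \<open>A pair p < q and a third index m form one increasing triple i < k < j. The three terms
  on the right belong to m in the middle, m last and m first, in this order.\<close>

lemma sum_over_pairs_and_third_index:
  fixes f :: "nat \<Rightarrow> nat \<Rightarrow> nat \<Rightarrow> complex"
  shows "(\<Sum>p<n. \<Sum>q<n. if p < q then \<Sum>m\<in>{..<n} - {p, q}. f p q m else 0) =
    (\<Sum>i<n. \<Sum>k<n. \<Sum>j<n. if i < k \<and> k < j then f i j k + f i k j + f k j i else 0)"
proof -
  have "(\<Sum>p<n. \<Sum>q<n. if p < q then \<Sum>m\<in>{..<n} - {p, q}. f p q m else 0) =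
      (\<Sum>p<n. \<Sum>q<n. \<Sum>m<n. (if p < m \<and> m < q then f p q m else 0) +
        (if p < q \<and> q < m then f p q m else 0) + (if m < p \<and> p < q then f p q m else 0))"
  proof (intro sum.cong refl)
    fix p q
    have "(\<Sum>m\<in>{..<n} - {p, q}. f p q m) = (\<Sum>m<n. if m = p \<or> m = q then 0 else f p q m)"
      by (rule sum.mono_neutral_cong_left) auto
    hence "(if p < q then \<Sum>m\<in>{..<n} - {p, q}. f p q m else 0) =
        (\<Sum>m<n. if p < q then if m = p \<or> m = q then 0 else f p q m else 0)" by simp
    also have "\<dots> = (\<Sum>m<n. (if p < m \<and> m < q then f p q m else 0) +
        (if p < q \<and> q < m then f p q m else 0) + (if m < p \<and> p < q then f p q m else 0))"
      by (intro sum.cong refl) auto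
    finally show "(if p < q then \<Sum>m\<in>{..<n} - {p, q}. f p q m else 0) =
        (\<Sum>m<n. (if p < m \<and> m < q then f p q m else 0) +
          (if p < q \<and> q < m then f p q m else 0) + (if m < p \<and> p < q then f p q m else 0))" .
  qed
  also have "\<dots> = (\<Sum>p<n. \<Sum>q<n. \<Sum>m<n. if p < m \<and> m < q then f p q m else 0) +
      (\<Sum>p<n. \<Sum>q<n. \<Sum>m<n. if p < q \<and> q < m then f p q m else 0) +
      (\<Sum>p<n. \<Sum>q<n. \<Sum>m<n. if m < p \<and> p < q then f p q m else 0)"
    by (simp add: sum.distrib)
  also have "(\<Sum>p<n. \<Sum>q<n. \<Sum>m<n. if p < m \<and> m < q then f p q m else 0) =
      (\<Sum>i<n. \<Sum>k<n. \<Sum>j<n. if i < k \<and> k < j then f i j k else 0)"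
    by (rule sum.cong[OF refl], rule sum.swap)
  also have "(\<Sum>p<n. \<Sum>q<n. \<Sum>m<n. if m < p \<and> p < q then f p q m else 0) =
      (\<Sum>p<n. \<Sum>m<n. \<Sum>q<n. if m < p \<and> p < q then f p q m else 0)"
    by (rule sum.cong[OF refl], rule sum.swap)
  also have "\<dots> = (\<Sum>i<n. \<Sum>k<n. \<Sum>j<n. if i < k \<and> k < j then f k j i else 0)"
    by (rule sum.swap)
  finally show ?thesis
    by (simp add: sum.distrib[symmetric] if_distrib[of "\<lambda>x. x + _"] cong: if_cong)
qed

text \<open>Entries \<open>i\<close> and \<open>k\<close> are chosen so that the off-diagonal terms of \<open>u\<^sup>* T u\<close> involving entry
  \<open>j\<close> cancel; the only one left is \<open>- t\<^sub>i\<^sub>k t\<^sub>k\<^sub>j cnj t\<^sub>i\<^sub>j\<close>.\<close>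

definition triple_vec :: "nat \<Rightarrow> complex mat \<Rightarrow> nat \<Rightarrow> nat \<Rightarrow> nat \<Rightarrow> complex vec" where
  "triple_vec n T i k j = vec n (\<lambda>x. if x = i then cnj (T $$ (k, j))
     else if x = k then - cnj (T $$ (i, j)) else if x = j then T $$ (i, k) else 0)"

text \<open>Each diagonal entry comes out multiplied by the squared modulus of the entry at the
  other two indices. This is the shape in which a sum over triples becomes a sum over pairs and a
  third index.\<close>

lemma triple_vec_form:
  assumes T: "T \<in> carrier_mat n n" "upper_triangular T" and ikj: "i < k" "k < j" "j < n"
  defines "u \<equiv> triple_vec n T i k j"
  shows "u \<bullet>c u = T $$ (i, j) * cnj (T $$ (i, j)) + T $$ (i, k) * cnj (T $$ (i, k)) +
      T $$ (k, j) * cnj (T $$ (k, j))"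
    and "(T *\<^sub>v u) \<bullet>c u = T $$ (k, k) * (T $$ (i, j) * cnj (T $$ (i, j))) +
      T $$ (j, j) * (T $$ (i, k) * cnj (T $$ (i, k))) +
      T $$ (i, i) * (T $$ (k, j) * cnj (T $$ (k, j))) - T $$ (i, k) * T $$ (k, j) * cnj (T $$ (i, j))"
proof -
  have u: "u \<in> carrier_vec n" by (simp add: u_def triple_vec_def)
  have ui: "u $ i = cnj (T $$ (k, j))" "u $ k = - cnj (T $$ (i, j))" "u $ j = T $$ (i, k)"
    using ikj by (auto simp: u_def triple_vec_def)
  have u0: "u $ x = 0" if "x < n" "x \<notin> {i, k, j}" for x
    using that by (simp add: u_def triple_vec_def)
  have red: "(\<Sum>x<n. g x) = g i + g k + g j" if "\<And>x. x < n \<Longrightarrow> x \<notin> {i, k, j} \<Longrightarrow> g x = 0"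
    for g :: "nat \<Rightarrow> complex"
  proof -
    have "(\<Sum>x<n. g x) = (\<Sum>x\<in>{i, k, j}. g x)"
      using ikj that by (intro sum.mono_neutral_right) auto
    thus ?thesis using ikj by (simp add: add.assoc)
  qed
  have "u \<bullet>c u = (\<Sum>x<n. u $ x * cnj (u $ x))"
    using u by (simp add: scalar_prod_conj_sum)
  also have "\<dots> = u $ i * cnj (u $ i) + u $ k * cnj (u $ k) + u $ j * cnj (u $ j)"
    by (rule red) (simp add: u0)
  finally show "u \<bullet>c u = T $$ (i, j) * cnj (T $$ (i, j)) + T $$ (i, k) * cnj (T $$ (i, k)) +
      T $$ (k, j) * cnj (T $$ (k, j))"
    unfolding ui by (simp add: algebra_simps)
  have low: "T $$ (k, i) = 0" "T $$ (j, i) = 0" "T $$ (j, k) = 0"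
    using T ikj by (auto simp: upper_triangular_def)
  have Tu: "(T *\<^sub>v u) $ x = T $$ (x, i) * u $ i + T $$ (x, k) * u $ k + T $$ (x, j) * u $ j"
    if "x < n" for x
  proof -
    have "(T *\<^sub>v u) $ x = (\<Sum>y<n. T $$ (x, y) * u $ y)"
      using T u that by (auto simp: scalar_prod_def lessThan_atLeast0)
    also have "\<dots> = T $$ (x, i) * u $ i + T $$ (x, k) * u $ k + T $$ (x, j) * u $ j"
      by (rule red) (simp add: u0)
    finally show ?thesis .
  qed
  have "(T *\<^sub>v u) \<bullet>c u = (\<Sum>x<n. (T *\<^sub>v u) $ x * cnj (u $ x))"
    using T u by (simp add: scalar_prod_conj_sum)
  also have "\<dots> = (T *\<^sub>v u) $ i * cnj (u $ i) + (T *\<^sub>v u) $ k * cnj (u $ k) + (T *\<^sub>v u) $ j * cnj (u $ j)"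
    by (rule red) (simp add: u0)
  finally show "(T *\<^sub>v u) \<bullet>c u = T $$ (k, k) * (T $$ (i, j) * cnj (T $$ (i, j))) +
      T $$ (j, j) * (T $$ (i, k) * cnj (T $$ (i, k))) +
      T $$ (i, i) * (T $$ (k, j) * cnj (T $$ (k, j))) - T $$ (i, k) * T $$ (k, j) * cnj (T $$ (i, j))"
    using ikj by (simp add: Tu ui low algebra_simps)
qed

lemma mat_trace_mult_adjoint:
  assumes "X \<in> carrier_mat n n" "T \<in> carrier_mat n n"
  shows "mat_trace (X * mat_adjoint T) = (\<Sum>p<n. \<Sum>q<n. X $$ (p, q) * cnj (T $$ (p, q)))"
  using assms by (auto simp: mat_trace_def scalar_prod_def lessThan_atLeast0 intro!: sum.cong)

lemma sum_upper_triangular: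
  fixes g :: "nat \<Rightarrow> nat \<Rightarrow> complex"
  assumes "\<And>p q. q < p \<Longrightarrow> p < n \<Longrightarrow> g p q = 0"
  shows "(\<Sum>p<n. \<Sum>q<n. g p q) = (\<Sum>p<n. g p p) + (\<Sum>p<n. \<Sum>q<n. if p < q then g p q else 0)"
proof -
  have "(\<Sum>p<n. \<Sum>q<n. g p q) = (\<Sum>p<n. \<Sum>q<n. (if q = p then g p p else 0) + (if p < q then g p q else 0))"
  proof (intro sum.cong refl)
    fix p q assume "p \<in> {..<n}" "q \<in> {..<n}"
    thus "g p q = (if q = p then g p p else 0) + (if p < q then g p q else 0)"
      using assms[of q p] by (cases p q rule: linorder_cases) auto
  qed
  also have "\<dots> = (\<Sum>p<n. g p p) + (\<Sum>p<n. \<Sum>q<n. if p < q then g p q else 0)"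
    by (simp add: sum.distrib)
  finally show ?thesis .
qed

text \<open>Triangularity confines the summation index to the range from p to q; its two endpoints
  give the first term.\<close>

lemma upper_triangular_square_entry:
  fixes T :: "complex mat"
  assumes T: "T \<in> carrier_mat n n" "upper_triangular T" and pq: "p < q" "q < n"
  shows "(T * T) $$ (p, q) = (T $$ (p, p) + T $$ (q, q)) * T $$ (p, q) +
    (\<Sum>m<n. if p < m \<and> m < q then T $$ (p, m) * T $$ (m, q) else 0)"
proof -
  have "(T * T) $$ (p, q) = (\<Sum>m<n. T $$ (p, m) * T $$ (m, q))"
    using T pq by (auto simp: scalar_prod_def lessThan_atLeast0)
  also have "\<dots> = (\<Sum>m<n. (if m = p then T $$ (p, p) * T $$ (p, q) else 0) +
      (if m = q then T $$ (p, q) * T $$ (q, q) else 0) +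
      (if p < m \<and> m < q then T $$ (p, m) * T $$ (m, q) else 0))"
  proof (intro sum.cong refl)
    fix m assume "m \<in> {..<n}"
    hence m: "m < n" by simp
    consider "m < p" | "m = p" | "p < m" "m < q" | "m = q" | "q < m" by linarith
    thus "T $$ (p, m) * T $$ (m, q) = (if m = p then T $$ (p, p) * T $$ (p, q) else 0) +
      (if m = q then T $$ (p, q) * T $$ (q, q) else 0) +
      (if p < m \<and> m < q then T $$ (p, m) * T $$ (m, q) else 0)"
    proof cases
      case 1
      hence "T $$ (p, m) = 0" using T pq by (auto simp: upper_triangular_def)
      with 1 pq show ?thesis by simp
    next
      case 5
      hence "T $$ (m, q) = 0" using T m by (auto simp: upper_triangular_def)
      with 5 pq show ?thesis by simp
    qed (use pq in auto)
  qed
  also have "\<dots> = (T $$ (p, p) + T $$ (q, q)) * T $$ (p, q) +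
    (\<Sum>m<n. if p < m \<and> m < q then T $$ (p, m) * T $$ (m, q) else 0)"
    using pq by (simp add: sum.distrib algebra_simps)
  finally show ?thesis .
qed

section \<open>The mean of the secondary values\<close>

text \<open>The squared Frobenius norm of the strictly upper part; for triangular \<open>T\<close>
  it will turn out to be tr(T M), with M the adjoint of \<open>T\<close> minus its bar.\<close>

definition upper_weight :: "nat \<Rightarrow> complex mat \<Rightarrow> complex" where
  "upper_weight n T = (\<Sum>p<n. \<Sum>q<n. if p < q then T $$ (p, q) * cnj (T $$ (p, q)) else 0)"

text \<open>The counterpart for tr(T T M): the first sum comes from the endpoints of the summation
  range in the entries of \<open>T * T\<close>, the second from its interior.\<close>

definition upper_moment :: "nat \<Rightarrow> complex mat \<Rightarrow> complex" where
  "upper_moment n T =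
     (\<Sum>p<n. \<Sum>q<n. if p < q then (T $$ (p, p) + T $$ (q, q)) * (T $$ (p, q) * cnj (T $$ (p, q))) else 0) +
     (\<Sum>i<n. \<Sum>k<n. \<Sum>j<n. if i < k \<and> k < j then T $$ (i, k) * T $$ (k, j) * cnj (T $$ (i, j)) else 0)"

text \<open>The diagonal is split off because, by \<open>mat_trace_mult_bar\<close>, it is exactly
  the part that the bar of \<open>T\<close> cancels.\<close>

lemma mat_trace_adjoint_upper_triangular:
  assumes T: "T \<in> carrier_mat n n" "upper_triangular T"
  shows "mat_trace (T * mat_adjoint T) = (\<Sum>p<n. T $$ (p, p) * cnj (T $$ (p, p))) + upper_weight n T"
    and "mat_trace (T * T * mat_adjoint T) =
      (\<Sum>p<n. (T * T) $$ (p, p) * cnj (T $$ (p, p))) + upper_moment n T"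
proof -
  have TT: "T * T \<in> carrier_mat n n" using T by simp
  have z: "T $$ (p, q) = 0" if "q < p" "p < n" for p q
    using that T by (auto simp: upper_triangular_def)
  show "mat_trace (T * mat_adjoint T) = (\<Sum>p<n. T $$ (p, p) * cnj (T $$ (p, p))) + upper_weight n T"
    unfolding mat_trace_mult_adjoint[OF T(1) T(1)] upper_weight_def
    by (rule sum_upper_triangular) (simp add: z)
  have "(\<Sum>p<n. \<Sum>q<n. if p < q then (T * T) $$ (p, q) * cnj (T $$ (p, q)) else 0) =
      (\<Sum>p<n. \<Sum>q<n. (if p < q then (T $$ (p, p) + T $$ (q, q)) * (T $$ (p, q) * cnj (T $$ (p, q))) else 0) +
        (\<Sum>m<n. if p < m \<and> m < q then T $$ (p, m) * T $$ (m, q) * cnj (T $$ (p, q)) else 0))"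
  proof (intro sum.cong refl)
    fix p q assume "p \<in> {..<n}" "q \<in> {..<n}"
    hence "q < n" by simp
    show "(if p < q then (T * T) $$ (p, q) * cnj (T $$ (p, q)) else 0) =
        (if p < q then (T $$ (p, p) + T $$ (q, q)) * (T $$ (p, q) * cnj (T $$ (p, q))) else 0) +
        (\<Sum>m<n. if p < m \<and> m < q then T $$ (p, m) * T $$ (m, q) * cnj (T $$ (p, q)) else 0)"
    proof (cases "p < q")
      case True
      have "(\<Sum>m<n. if p < m \<and> m < q then T $$ (p, m) * T $$ (m, q) else 0) * cnj (T $$ (p, q)) =
          (\<Sum>m<n. if p < m \<and> m < q then T $$ (p, m) * T $$ (m, q) * cnj (T $$ (p, q)) else 0)"
        unfolding sum_distrib_right by (intro sum.cong refl) auto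
      thus ?thesis
        using True by (simp add: upper_triangular_square_entry[OF T True \<open>q < n\<close>] distrib_right mult.assoc)
    next
      case False
      hence "(\<Sum>m<n. if p < m \<and> m < q then T $$ (p, m) * T $$ (m, q) * cnj (T $$ (p, q)) else 0) = 0"
        by (intro sum.neutral) auto
      with False show ?thesis by simp
    qed
  qed
  also have "\<dots> = (\<Sum>p<n. \<Sum>q<n. if p < q then (T $$ (p, p) + T $$ (q, q)) * (T $$ (p, q) * cnj (T $$ (p, q))) else 0) +
      (\<Sum>p<n. \<Sum>q<n. \<Sum>m<n. if p < m \<and> m < q then T $$ (p, m) * T $$ (m, q) * cnj (T $$ (p, q)) else 0)"
    by (simp add: sum.distrib)
  also have "(\<Sum>p<n. \<Sum>q<n. \<Sum>m<n. if p < m \<and> m < q then T $$ (p, m) * T $$ (m, q) * cnj (T $$ (p, q)) else 0) =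
      (\<Sum>p<n. \<Sum>m<n. \<Sum>q<n. if p < m \<and> m < q then T $$ (p, m) * T $$ (m, q) * cnj (T $$ (p, q)) else 0)"
    by (rule sum.cong[OF refl], rule sum.swap)
  finally have off: "(\<Sum>p<n. \<Sum>q<n. if p < q then (T * T) $$ (p, q) * cnj (T $$ (p, q)) else 0) = upper_moment n T"
    unfolding upper_moment_def .
  show "mat_trace (T * T * mat_adjoint T) =
      (\<Sum>p<n. (T * T) $$ (p, p) * cnj (T $$ (p, p))) + upper_moment n T"
    unfolding mat_trace_mult_adjoint[OF TT T(1)] off[symmetric]
    by (rule sum_upper_triangular) (simp add: z)
qed

lemma upper_weight_eq_0:
  assumes T: "T \<in> carrier_mat n n" "upper_triangular T" and "upper_weight n T = 0" "i < n" "j < n" "i \<noteq> j"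
  shows "T $$ (i, j) = 0"
proof (cases "i < j")
  case True
  define g where "g p q = (if p < q then (cmod (T $$ (p, q)))\<^sup>2 else 0)" for p q
  have g: "g p q \<ge> 0" for p q by (simp add: g_def)
  have "(if p < q then T $$ (p, q) * cnj (T $$ (p, q)) else 0) = of_real (g p q)" for p q
    using complex_norm_square[of "T $$ (p, q)"] by (simp add: g_def)
  hence "upper_weight n T = of_real (\<Sum>p<n. \<Sum>q<n. g p q)"
    unfolding upper_weight_def of_real_sum by simp
  hence "complex_of_real (\<Sum>p<n. \<Sum>q<n. g p q) = 0" unfolding assms(3) by (rule sym)
  hence "(\<Sum>p<n. \<Sum>q<n. g p q) = 0" unfolding of_real_eq_0_iff .
  hence "(\<Sum>q<n. g i q) = 0"
    using sum_nonneg_eq_0_iff[of "{..<n}" "\<lambda>p. \<Sum>q<n. g p q"] g \<open>i < n\<close> by (simp add: sum_nonneg)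
  hence "g i j = 0"
    using sum_nonneg_eq_0_iff[of "{..<n}" "g i"] g \<open>j < n\<close> by simp
  with True show ?thesis by (simp add: g_def)
next
  case False
  with assms show ?thesis by (auto simp: upper_triangular_def)
qed

text \<open>\<open>numerical_range_sum\<close> is applied to the triple vectors. Every pair p < q
  has n - 2 third indices, which gives the factor in the denominator. The diagonal entries at these
  indices add up to the trace without the entries at p and q, and what is taken away, together with
  the cubic terms, is \<open>upper_moment\<close>.\<close>

lemma upper_triangular_mean_in_numerical_range:
  assumes T: "T \<in> carrier_mat n n" "upper_triangular T" and n: "n \<ge> 3" and D: "upper_weight n T \<noteq> 0"
  shows "(mat_trace T - upper_moment n T / upper_weight n T) / of_nat (n - 2) \<in> numerical_range T"
proof -
  define w where "w p q = T $$ (p, q) * cnj (T $$ (p, q))" for p q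
  \<comment> \<open>The zero vector at triples that are not increasing lets the sum run over the
    whole cube \<open>I\<close> without changing either total.\<close>
  define u where "u = (\<lambda>(i, k, j). if i < k \<and> k < j then triple_vec n T i k j else 0\<^sub>v n)"
  define I where "I = {..<n} \<times> {..<n} \<times> {..<n}"
  have u: "u x \<in> carrier_vec n" for x
    by (auto simp: u_def triple_vec_def split: prod.split)
  have sumI: "(\<Sum>x\<in>I. g x) = (\<Sum>i<n. \<Sum>k<n. \<Sum>j<n. g (i, k, j))" for g :: "nat \<times> nat \<times> nat \<Rightarrow> complex"
    by (simp add: I_def sum.cartesian_product)
  have rest: "(\<Sum>m\<in>{..<n} - {p, q}. g m) = (\<Sum>m<n. g m) - g p - g q" if "p < q" "q < n"
    for p q and g :: "nat \<Rightarrow> complex"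
  proof -
    have "(\<Sum>m\<in>{..<n} - {p, q}. g m) = (\<Sum>m<n. g m) - (\<Sum>m\<in>{p, q}. g m)"
      using that by (intro sum_diff) auto
    thus ?thesis using that by simp
  qed
  have norm: "(\<Sum>x\<in>I. u x \<bullet>c u x) = of_nat (n - 2) * upper_weight n T"
  proof -
    have "(\<Sum>x\<in>I. u x \<bullet>c u x) =
        (\<Sum>i<n. \<Sum>k<n. \<Sum>j<n. if i < k \<and> k < j then w i j + w i k + w k j else 0)"
      unfolding sumI
      by (intro sum.cong refl) (auto simp: u_def w_def triple_vec_form[OF T])
    also have "\<dots> = (\<Sum>p<n. \<Sum>q<n. if p < q then \<Sum>m\<in>{..<n} - {p, q}. w p q else 0)"
      by (rule sum_over_pairs_and_third_index[symmetric])
    also have "\<dots> = (\<Sum>p<n. \<Sum>q<n. of_nat (n - 2) * (if p < q then w p q else 0))"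
    proof (intro sum.cong refl)
      fix p q assume "p \<in> {..<n}" "q \<in> {..<n}"
      hence "card ({..<n} - {p, q}) = n - 2" if "p < q"
        using that by (subst card_Diff_subset) auto
      thus "(if p < q then \<Sum>m\<in>{..<n} - {p, q}. w p q else 0) = of_nat (n - 2) * (if p < q then w p q else 0)"
        by simp
    qed
    finally show ?thesis unfolding upper_weight_def w_def sum_distrib_left .
  qed
  have "(\<Sum>x\<in>I. (T *\<^sub>v u x) \<bullet>c u x) = (\<Sum>i<n. \<Sum>k<n. \<Sum>j<n.
      (if i < k \<and> k < j then T $$ (k, k) * w i j + T $$ (j, j) * w i k + T $$ (i, i) * w k j else 0) -
      (if i < k \<and> k < j then T $$ (i, k) * T $$ (k, j) * cnj (T $$ (i, j)) else 0))"
    unfolding sumI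
    using T by (intro sum.cong refl) (auto simp: u_def w_def triple_vec_form[OF T])
  also have "\<dots> = (\<Sum>i<n. \<Sum>k<n. \<Sum>j<n.
      if i < k \<and> k < j then T $$ (k, k) * w i j + T $$ (j, j) * w i k + T $$ (i, i) * w k j else 0) -
      (\<Sum>i<n. \<Sum>k<n. \<Sum>j<n. if i < k \<and> k < j then T $$ (i, k) * T $$ (k, j) * cnj (T $$ (i, j)) else 0)"
    by (simp add: sum_subtractf)
  also have "(\<Sum>i<n. \<Sum>k<n. \<Sum>j<n.
      if i < k \<and> k < j then T $$ (k, k) * w i j + T $$ (j, j) * w i k + T $$ (i, i) * w k j else 0) =
      (\<Sum>p<n. \<Sum>q<n. if p < q then \<Sum>m\<in>{..<n} - {p, q}. T $$ (m, m) * w p q else 0)"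
    by (rule sum_over_pairs_and_third_index[of "\<lambda>p q m. T $$ (m, m) * w p q", symmetric])
  also have "\<dots> = (\<Sum>p<n. \<Sum>q<n. mat_trace T * (if p < q then w p q else 0) -
      (if p < q then (T $$ (p, p) + T $$ (q, q)) * w p q else 0))"
  proof (intro sum.cong refl)
    fix p q assume "p \<in> {..<n}" "q \<in> {..<n}"
    hence "(\<Sum>m\<in>{..<n} - {p, q}. T $$ (m, m) * w p q) =
        (mat_trace T - T $$ (p, p) - T $$ (q, q)) * w p q" if "p < q"
      using rest[OF that] T unfolding sum_distrib_right[symmetric] by (simp add: mat_trace_def)
    thus "(if p < q then \<Sum>m\<in>{..<n} - {p, q}. T $$ (m, m) * w p q else 0) =
        mat_trace T * (if p < q then w p q else 0) - (if p < q then (T $$ (p, p) + T $$ (q, q)) * w p q else 0)"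
      by (simp add: algebra_simps)
  qed
  also have "\<dots> = mat_trace T * upper_weight n T -
      (\<Sum>p<n. \<Sum>q<n. if p < q then (T $$ (p, p) + T $$ (q, q)) * w p q else 0)"
    unfolding upper_weight_def w_def by (simp add: sum_subtractf sum_distrib_left)
  finally have form: "(\<Sum>x\<in>I. (T *\<^sub>v u x) \<bullet>c u x) = mat_trace T * upper_weight n T - upper_moment n T"
    unfolding upper_moment_def w_def by (simp add: algebra_simps)
  have "complex_of_nat (n - 2) \<noteq> 0" using n unfolding of_nat_eq_0_iff by simp
  hence "of_nat (n - 2) * upper_weight n T \<noteq> 0" using D by (metis mult_eq_0_iff)
  hence "(\<Sum>x\<in>I. (T *\<^sub>v u x) \<bullet>c u x) / (\<Sum>x\<in>I. u x \<bullet>c u x) \<in> numerical_range T"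
    unfolding norm[symmetric]
    by (intro numerical_range_sum[OF T(1)] u) (simp_all add: I_def)
  also have "(\<Sum>x\<in>I. (T *\<^sub>v u x) \<bullet>c u x) / (\<Sum>x\<in>I. u x \<bullet>c u x) =
      (mat_trace T - upper_moment n T / upper_weight n T) / of_nat (n - 2)"
    unfolding form norm mult.commute[of "of_nat (n - 2)"] divide_divide_eq_left[symmetric]
    using D by (simp add: diff_divide_distrib)
  finally show ?thesis .
qed

section \<open>Unitary invariance\<close>

lemma numerical_range_unitary:
  assumes U: "unitary_mat n U" and T: "T \<in> carrier_mat n n"
  shows "numerical_range T \<subseteq> numerical_range (U * T * mat_adjoint U)"
proof
  fix z assume "z \<in> numerical_range T"
  then obtain w where w: "w \<in> carrier_vec n" "w \<noteq> 0\<^sub>v n" "(T *\<^sub>v w) \<bullet>c w = z * (w \<bullet>c w)"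
    using numerical_rangeE[OF T] by blast
  have Uc: "U \<in> carrier_mat n n" and UU: "mat_adjoint U * U = 1\<^sub>m n"
    using U by (auto simp: unitary_mat_def)
  note Ua = mat_adjoint_carrier[OF Uc]
  \<comment> \<open>\<open>U\<close> preserves scalar products, so the Rayleigh quotient of
    \<open>T\<close> at \<open>w\<close> equals that of the conjugated matrix at
    \<open>U *\<^sub>v w\<close>.\<close>
  have iso: "(U *\<^sub>v x) \<bullet>c (U *\<^sub>v y) = x \<bullet>c y" if "x \<in> carrier_vec n" "y \<in> carrier_vec n" for x y
  proof -
    have "(U *\<^sub>v x) \<bullet>c (U *\<^sub>v y) = x \<bullet>c (mat_adjoint U *\<^sub>v (U *\<^sub>v y))"
      using that Uc by (intro mult_mat_vec_cscalar_prod[of _ n n]) auto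
    also have "mat_adjoint U *\<^sub>v (U *\<^sub>v y) = (mat_adjoint U * U) *\<^sub>v y"
      by (rule assoc_mult_mat_vec[OF Ua Uc that(2), symmetric])
    finally show ?thesis unfolding UU using that by simp
  qed
  have "U * T * mat_adjoint U * U = U * T * (mat_adjoint U * U)"
    by (rule assoc_mult_mat[of _ n n _ n]) (use Uc Ua T in auto)
  also have "\<dots> = U * T" unfolding UU using Uc T by (simp add: right_mult_one_mat[of _ n n])
  finally have "U * T * mat_adjoint U * U = U * T" .
  moreover have AU: "U * T * mat_adjoint U \<in> carrier_mat n n" using Uc Ua T by auto
  ultimately have "(U * T * mat_adjoint U) *\<^sub>v (U *\<^sub>v w) = U *\<^sub>v (T *\<^sub>v w)"
    using assoc_mult_mat_vec[OF AU Uc w(1)] assoc_mult_mat_vec[OF Uc T w(1)] by simp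
  hence "((U * T * mat_adjoint U) *\<^sub>v (U *\<^sub>v w)) \<bullet>c (U *\<^sub>v w) = z * ((U *\<^sub>v w) \<bullet>c (U *\<^sub>v w))"
    using iso w T by simp
  moreover have "U *\<^sub>v w \<noteq> 0\<^sub>v n"
  proof
    assume "U *\<^sub>v w = 0\<^sub>v n"
    hence "w \<bullet>c w = 0" using iso[OF w(1) w(1)] by simp
    thus False using w by simp
  qed
  ultimately show "z \<in> numerical_range (U * T * mat_adjoint U)"
    using Uc w(1) by (intro numerical_rangeI[OF AU]) auto
qed

lemma mult_unitary_similar:
  assumes U: "unitary_mat n U" and X: "X \<in> carrier_mat n n" and Y: "Y \<in> carrier_mat n n"
  shows "(U * X * mat_adjoint U) * (U * Y * mat_adjoint U) = U * (X * Y) * mat_adjoint U"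
proof -
  have Uc: "U \<in> carrier_mat n n" and UU: "mat_adjoint U * U = 1\<^sub>m n"
    using U by (auto simp: unitary_mat_def)
  note Ua = mat_adjoint_carrier[OF Uc]
  have "(U * X * mat_adjoint U) * (U * Y * mat_adjoint U) = U * X * (mat_adjoint U * U) * Y * mat_adjoint U"
    using Uc Ua X Y by (simp add: assoc_mult_mat[of _ n n _ n _ n] mult_carrier_mat[of _ n n])
  also have "\<dots> = U * (X * Y) * mat_adjoint U"
    unfolding UU using Uc Ua X Y
    by (simp add: right_mult_one_mat[of _ n n] assoc_mult_mat[of _ n n _ n _ n])
  finally show ?thesis .
qed

lemma mat_adjoint_unitary_similar:
  assumes U: "unitary_mat n U" and X: "X \<in> carrier_mat n n"
  shows "mat_adjoint (U * X * mat_adjoint U) = U * mat_adjoint X * mat_adjoint U"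
proof -
  have Uc: "U \<in> carrier_mat n n" using U by (auto simp: unitary_mat_def)
  note Ua = mat_adjoint_carrier[OF Uc] and Xa = mat_adjoint_carrier[OF X]
  have "mat_adjoint (U * X * mat_adjoint U) = U * (mat_adjoint X * mat_adjoint U)"
    using mat_adjoint_mult[OF mult_carrier_mat[OF Uc X] Ua] mat_adjoint_mult[OF Uc X] by simp
  thus ?thesis using assoc_mult_mat[OF Uc Xa Ua] by simp
qed

lemma normal_mat_unitary_diagonal:
  assumes U: "unitary_mat n U" and T: "T \<in> carrier_mat n n"
    and diag: "\<And>i j. i < n \<Longrightarrow> j < n \<Longrightarrow> i \<noteq> j \<Longrightarrow> T $$ (i, j) = 0"
  shows "normal_mat (U * T * mat_adjoint U)"
proof -
  note Ta = mat_adjoint_carrier[OF T]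
  have "T * mat_adjoint T = mat_adjoint T * T"
  proof (intro eq_matI)
    fix i j assume "i < dim_row (mat_adjoint T * T)" "j < dim_col (mat_adjoint T * T)"
    hence ij: "i < n" "j < n" using T by auto
    have "(\<Sum>k<n. T $$ (i, k) * cnj (T $$ (j, k))) = (\<Sum>k<n. cnj (T $$ (k, i)) * T $$ (k, j))"
    proof (intro sum.cong refl)
      fix k assume "k \<in> {..<n}"
      thus "T $$ (i, k) * cnj (T $$ (j, k)) = cnj (T $$ (k, i)) * T $$ (k, j)"
        using diag[of i k] diag[of j k] diag[of k i] diag[of k j] ij
        by (cases "k = i"; cases "k = j") auto
    qed
    thus "(T * mat_adjoint T) $$ (i, j) = (mat_adjoint T * T) $$ (i, j)"
      using T Ta ij by (auto simp: scalar_prod_def lessThan_atLeast0)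
  qed (use T in auto)
  thus ?thesis
    unfolding normal_mat_def mat_adjoint_unitary_similar[OF U T]
    by (simp add: mult_unitary_similar[OF U] T Ta)
qed

text \<open>Since tr M = 0, the recursion gives coefficient 0 at x^(n-1), tr(A M) at x^(n-2), and
  tr(A A M) - tr A tr(A M) at x^(n-3). Vieta's formula finishes, the degree being exactly n - 2
  because tr(A M) is nonzero.\<close>

lemma sum_secondary_values:
  assumes A: "A \<in> carrier_mat n n" and B: "B \<in> carrier_mat n n" and n: "n \<ge> 3"
    and M: "M = mat_adjoint A - B" and tr: "mat_trace M = 0" "mat_trace (A * M) \<noteq> 0"
  shows "(\<Sum>x\<in>#secondary_values A B. x) = mat_trace A - mat_trace (A * A * M) / mat_trace (A * M)"
proof -
  have Mc: "M \<in> carrier_mat n n" unfolding M by (rule minus_carrier_mat[OF B])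
  note AM = mult_carrier_mat[OF A Mc]
  note AAM = mult_carrier_mat[OF A AM]
  have "n = Suc (Suc (Suc (n - 3)))" using n by linarith
  then obtain l where l: "n = Suc (Suc (Suc l))" by blast
  let ?p = "adj_trace_poly A"
  have p: "secondary_poly A B = ?p M" by (simp add: secondary_poly_def adj_trace_poly_def M)
  note c = coeff_adj_trace_poly[OF A]
  \<comment> \<open>At index n - 1 only the leading coefficient 1 of the characteristic polynomial
    survives in the recursion.\<close>
  have top: "coeff (?p X) (Suc (Suc l)) = mat_trace X" if "X \<in> carrier_mat n n" for X
    using c[OF that, of "Suc (Suc l)"] coeff_adj_trace_poly_eq_0[OF A, of "A * X" n] that A degree_monic_char_poly[OF A]
    by (simp add: l)
  have c1: "coeff (?p M) (Suc l) = mat_trace (A * M)"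
    using c[OF Mc, of "Suc l"] top[OF AM] tr by simp
  have "coeff (?p (A * M)) (Suc l) = - mat_trace A * mat_trace (A * M) + mat_trace (A * (A * M))"
    using c[OF AM, of "Suc l"] top[OF AAM] coeff_char_poly_mat_trace[OF A l] by (simp add: mult.commute)
  hence c0: "coeff (?p M) l = - mat_trace A * mat_trace (A * M) + mat_trace (A * (A * M))"
    using c[OF Mc, of l] tr by simp
  have "coeff (?p M) k = 0" if "k > Suc l" for k
  proof (cases "k = Suc (Suc l)")
    case True
    thus ?thesis using top[OF Mc] tr by simp
  next
    case False
    thus ?thesis using that l by (intro coeff_adj_trace_poly_eq_0[OF A Mc]) simp
  qed
  hence deg: "degree (?p M) = Suc l"
    using c1 tr by (intro antisym degree_le le_degree) auto
  have "A * A * M = A * (A * M)" by (rule assoc_mult_mat[OF A A Mc])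
  thus ?thesis
    using tr unfolding secondary_values_def p sum_proots_complex[OF deg] c0 c1 by (simp add: field_simps)
qed

theorem proposition70:
  fixes n :: nat and A :: "complex mat" and cj :: "complex mat \<Rightarrow> complex mat"
  assumes "n \<ge> 3"
    and "A \<in> carrier_mat n n"
    and "\<not> normal_mat A"
    and "bar_operation n cj"
  shows "(\<Sum>x\<in>#secondary_values A (cj A). x) / of_nat (n - 2) \<in> numerical_range A"
proof -
  note A = assms(2)
  obtain U T where U: "unitary_mat n U" and T: "T \<in> carrier_mat n n" "upper_triangular T"
    and AU: "A = U * T * mat_adjoint U"
    using unitary_schur[OF A] by blast
  have Uc: "U \<in> carrier_mat n n" and Ua: "mat_adjoint U \<in> carrier_mat n n"
    and UU: "mat_adjoint U * U = 1\<^sub>m n" "U * mat_adjoint U = 1\<^sub>m n"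
    using U mat_adjoint_carrier by (auto simp: unitary_mat_def)
  define B where "B = cj T"
  define M where "M = mat_adjoint T - B"
  have B: "B \<in> carrier_mat n n" "B * T = T * B"
    and Bev: "\<And>u \<mu>. eigenvector T u \<mu> \<Longrightarrow> B *\<^sub>v u = cnj \<mu> \<cdot>\<^sub>v u"
    using assms(4) T(1) unfolding bar_operation_def B_def by blast+
  have inv: "inverts_mat (mat_adjoint U) U" "inverts_mat U (mat_adjoint U)"
    using UU Uc by (simp_all add: inverts_mat_def)
  have similar: "cj (P * X * Q) = P * cj X * Q"
    if "X \<in> carrier_mat n n" "Q \<in> carrier_mat n n" "P \<in> carrier_mat n n"
      "inverts_mat Q P" "inverts_mat P Q" for X P Q
    using assms(4) that unfolding bar_operation_def by blast
  \<comment> \<open>Compatibility of the bar operation with similarity carries it along the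
    triangularization, with \<open>mat_adjoint U\<close> as the inverse of \<open>U\<close>.\<close>
  have cjA: "cj A = U * B * mat_adjoint U"
    unfolding AU B_def by (rule similar[OF T(1) Ua Uc inv])
  have cjAc: "cj A \<in> carrier_mat n n"
    unfolding cjA by (intro mult_carrier_mat[of _ n n] Uc Ua B)
  note Ta = mat_adjoint_carrier[OF T(1)]
  have M: "M \<in> carrier_mat n n" unfolding M_def by (rule minus_carrier_mat[OF B(1)])
  have AM: "mat_adjoint A - cj A = U * M * mat_adjoint U"
    unfolding AU[THEN arg_cong, of mat_adjoint] mat_adjoint_unitary_similar[OF U T(1)] cjA M_def
    using Uc Ua Ta B
    by (simp add: mult_minus_distrib_mat[of _ n n] minus_mult_distrib_mat[of _ n n])
  have tr: "mat_trace (U * X * mat_adjoint U) = mat_trace X" if "X \<in> carrier_mat n n" for X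
    using that Uc Ua UU by (intro mat_trace_similar)
  have trA: "mat_trace (mat_adjoint A - cj A) = mat_trace M"
    "mat_trace (A * (mat_adjoint A - cj A)) = mat_trace (T * M)"
    "mat_trace (A * A * (mat_adjoint A - cj A)) = mat_trace (T * T * M)"
    "mat_trace A = mat_trace T"
    unfolding AM unfolding AU
    using T M by (simp_all add: mult_unitary_similar[OF U] tr)
  \<comment> \<open>To be used with \<open>X\<close> equal to the identity, \<open>T\<close> and
    \<open>T * T\<close>; in each case the bar removes the diagonal contribution.\<close>
  have bar: "mat_trace (X * M) = mat_trace (X * mat_adjoint T) - (\<Sum>i<n. X $$ (i, i) * cnj (T $$ (i, i)))"
    if X: "X \<in> carrier_mat n n" "upper_triangular X" "X * T = T * X" for X
  proof -
    have "X * M = X * mat_adjoint T - X * B"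
      unfolding M_def using X Ta B by (simp add: mult_minus_distrib_mat[of _ n n])
    thus ?thesis
      using X Ta B mat_trace_diff[of "X * mat_adjoint T" n "X * B"]
        mat_trace_mult_bar[OF T B Bev X] by simp
  qed
  have "mat_trace (1\<^sub>m n * M) = mat_trace (1\<^sub>m n * mat_adjoint T) - (\<Sum>i<n. 1\<^sub>m n $$ (i, i) * cnj (T $$ (i, i)))"
    using T by (intro bar) auto
  hence tr0: "mat_trace M = 0" using M Ta T by (simp add: mat_trace_def)
  have tr1: "mat_trace (T * M) = upper_weight n T"
    using bar[OF T] mat_trace_adjoint_upper_triangular(1)[OF T] by simp
  have tr2: "mat_trace (T * T * M) = upper_moment n T"
    using bar[of "T * T"] mat_trace_adjoint_upper_triangular(2)[OF T] T upper_triangular_mult(1)[OF T T]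
    by (simp add: assoc_mult_mat[of _ n n _ n _ n])
  \<comment> \<open>A vanishing weight would make \<open>T\<close> diagonal and hence
    \<open>A\<close> normal.\<close>
  have D: "upper_weight n T \<noteq> 0"
    using upper_weight_eq_0[OF T] normal_mat_unitary_diagonal[OF U T(1)] assms(3) unfolding AU by blast
  have "(\<Sum>x\<in>#secondary_values A (cj A). x) = mat_trace T - upper_moment n T / upper_weight n T"
    by (rule sum_secondary_values[OF A cjAc assms(1) refl, unfolded trA tr0 tr1 tr2, OF refl D])
  thus ?thesis
    using upper_triangular_mean_in_numerical_range[OF T assms(1) D] numerical_range_unitary[OF U T(1)]
    unfolding AU by auto
qed

end
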